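(* Let $q$ be a prime power, $n\geq 1$, and let $T$ be a linear operator on $\mathbb{F}_q^n$ whose characteristic polynomial is irreducible over $\mathbb{F}_q$. Let $\mu=(\mu_1,\mu_2,\ldots)$ be a partition of $n$. Then the number $\sigma(\mu,T)$ of subspaces $W\subseteq\mathbb{F}_q^n$ with $T$-profile $\mu$ equals \[ \sigma(\mu,T)=\frac{q^n-1}{q^{\mu_1}-1}\,q^{\sum_{j\geq 2}(\mu_j^2-\mu_j)}\prod_{i\geq 1}{\mu_i \brack \mu_{i+1}}_q . \]
   Context: A partition of $n$ is a weakly decreasing sequence $(\mu_1,\mu_2,\ldots)$ of nonnegative integers with sum $n$ (trailing zeros are ignored). For a linear operator $T$ on $\mathbb{F}_q^n$, a subspace $W$ has $T$-profile $\mu$ if $\dim(W+TW+\cdots+T^{j-1}W)=\mu_1+\cdots+\mu_j$ for all $j\geq 1$; $\sigma(\mu,T)$ denotes the number of subspaces with $T$-profile $\mu$. The $q$-binomial coefficient ${a\brack b}_q$ is the number of $b$-dimensional subspaces of $\mathbb{F}_q^a$. *)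

theory Defs
  imports
    "HOL-Analysis.Analysis"
    "HOL-Computational_Algebra.Computational_Algebra"
    "HOL-Library.Function_Algebras"
begin

text \<open>
  The space \<open>F\<^sub>q\<^sup>n\<close> is \<^typ>\<open>'a^'n\<close> with \<^typ>\<open>'a\<close> a finite field type, so that
  \<open>q = CARD('a)\<close> and \<open>n = CARD('n)\<close>; \<open>vec.subspace\<close> and \<open>vec.dim\<close> are taken with respect
  to the scalars in \<^typ>\<open>'a\<close>.
\<close>

text \<open>
  The parts of \<open>\<mu>\<close> are \<open>\<mu> 1, \<mu> 2, \<dots>\<close>; the value \<open>\<mu> 0\<close> is irrelevant.
\<close>

definition partition_of :: "nat \<Rightarrow> (nat \<Rightarrow> nat) \<Rightarrow> bool" where
  "partition_of n \<mu> \<longleftrightarrow>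
     (\<forall>i j. 1 \<le> i \<longrightarrow> i \<le> j \<longrightarrow> \<mu> j \<le> \<mu> i) \<and>
     finite {i. 1 \<le> i \<and> \<mu> i \<noteq> 0} \<and>
     (\<Sum>i | 1 \<le> i \<and> \<mu> i \<noteq> 0. \<mu> i) = n"

text \<open>The subspace \<open>W + T W + \<dots> + T\<^sup>j\<^sup>-\<^sup>1 W\<close>.\<close>

definition iterate_sum :: "('a::field^'n \<Rightarrow> 'a^'n) \<Rightarrow> nat \<Rightarrow> ('a^'n) set \<Rightarrow> ('a^'n) set" where
  "iterate_sum T j W = {(\<Sum>i<j. (T ^^ i) (w i)) | w. \<forall>i<j. w i \<in> W}"

definition has_profile :: "('a::field^'n \<Rightarrow> 'a^'n) \<Rightarrow> (nat \<Rightarrow> nat) \<Rightarrow> ('a^'n) set \<Rightarrow> bool" where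
  "has_profile T \<mu> W \<longleftrightarrow>
     vec.subspace W \<and> (\<forall>j\<ge>1. vec.dim (iterate_sum T j W) = (\<Sum>i=1..j. \<mu> i))"

definition profile_count :: "(nat \<Rightarrow> nat) \<Rightarrow> ('a::{field,finite}^'n \<Rightarrow> 'a^'n) \<Rightarrow> nat" where
  "profile_count \<mu> T = card {W. has_profile T \<mu> W}"

definition charpoly :: "('a::field^'n \<Rightarrow> 'a^'n) \<Rightarrow> 'a poly" where
  "charpoly T = det (\<chi> i j. (if i = j then [:0, 1:] else 0) - [:matrix T $ i $ j:])"

text \<open>
  The dimension \<open>a\<close> of the ambient space of a \<open>q\<close>-binomial coefficient varies over the natural
  numbers, so here \<open>F\<^sub>q\<^sup>a\<close> is the space of functions \<^typ>\<open>nat \<Rightarrow> 'a\<close> vanishing outside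
  \<open>{..<a}\<close>.
\<close>

interpretation fun_space: vector_space "\<lambda>(c::'a::field) (f::nat \<Rightarrow> 'a) i. c * f i"
  by unfold_locales (auto simp: fun_eq_iff algebra_simps)

definition coord_space :: "nat \<Rightarrow> (nat \<Rightarrow> 'a::field) set" where
  "coord_space a = {f. \<forall>i\<ge>a. f i = 0}"

definition q_binomial :: "'a::{field,finite} itself \<Rightarrow> nat \<Rightarrow> nat \<Rightarrow> nat" where
  "q_binomial _ a b =
     card {U :: (nat \<Rightarrow> 'a) set. fun_space.subspace U \<and> U \<subseteq> coord_space a \<and> fun_space.dim U = b}"

end

theory Submission
  imports Defs "HOL-Library.Set_Algebras"
begin

text \<open>
  Write \<open>V\<close> for the ambient space and \<open>v\<close> for a nonzero vector. As the characteristic polynomial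
  of \<open>T\<close> is irreducible, \<open>v\<close> is cyclic, and it is enough to show that the number of subspaces
  through \<open>v\<close> with profile \<open>\<mu>\<close> is
  \<open>b(\<mu>) = \<Prod> [\<mu>\<^sub>i, \<mu>\<^sub>i\<^sub>+\<^sub>1]\<^sub>q q ^ (\<mu>\<^sub>i\<^sub>+\<^sub>1\<^sup>2 - \<mu>\<^sub>i\<^sub>+\<^sub>1)\<close>: counting the pairs \<open>v \<in> W\<close> in two ways then
  gives \<open>\<sigma>(\<mu>, T) (q ^ \<mu>\<^sub>1 - 1) = (q ^ n - 1) b(\<mu>)\<close>.

  The profile of a subspace \<open>W\<close> containing \<open>v\<close> depends only on \<open>T\<close> modulo \<open>v\<close>, and modulo \<open>v\<close> any two
  operators with cyclic vector \<open>v\<close> are conjugate by an automorphism fixing \<open>v\<close>, because both can be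
  changed into a nilpotent Jordan block. So the number of \<open>W\<close> may be averaged over all operators
  modulo \<open>v\<close> that are reachable from \<open>v\<close>, i.e. one may fix \<open>W\<close> and count operators. This is done in two
  steps. First, the operators modulo \<open>W\<close> with a given profile are counted by passing from \<open>V\<close> to a
  complement of \<open>W\<close>, which removes the first part of the profile. Second, an operator modulo \<open>W\<close> that is
  reachable from \<open>W\<close> is lifted to an operator modulo \<open>v\<close> by shrinking \<open>W\<close> one dimension at a time; the
  number of lifts that stay reachable depends only on dimensions.
\<close>

section \<open>Products and Gaussian binomial coefficients\<close>

text \<open>Irreducibility is used once: by Cayley-Hamilton an annihilator of \<open>v\<close> of
  least degree divides the characteristic polynomial, so it has degree at least n and no proper
  invariant subspace contains \<open>v\<close>. For one operator the subspaces through
  \<open>v\<close> cannot be built by independent choices; for a fixed \<open>W\<close> the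
  operators can, because they split into linear maps between summands. Lifts can be counted because,
  when \<open>W\<close> shrinks by a line, exactly \<open>q ^ (dim C + 1)\<close> lifts fail, with
  \<open>C\<close> a complement of the larger space, whatever the operator was. Put m = n - 1 and c
  = n - mu_1. A fixed \<open>W\<close> is met by q^c \<open>qfall q c c\<close> b(mu) Q operators,
  where Q, the product of q^n - q^i over c < i <= m, counts the lifts. All reachable operators
  number q^c \<open>qfall q m c\<close> Q, and there are [m, c]_q spaces \<open>W\<close>.
  Cancelling q^c Q and using [m, c]_q \<open>qfall q c c\<close> = \<open>qfall q m c\<close> leaves
  b(mu). Here \<open>qfall q a b\<close> is the number of ordered independent
  \<open>b\<close>-tuples in dimension \<open>a\<close>. Identities are kept multiplied out, so that
  they live in \<open>nat\<close>; the only division comes at the very end.\<close>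

definition qfall :: "nat \<Rightarrow> nat \<Rightarrow> nat \<Rightarrow> nat" where
  "qfall q a b = (\<Prod>t<b. q ^ a - q ^ t)"

text \<open>The Gaussian binomial, introduced by a Pascal rule instead of a count: this recurrence
  is the one that arises when a line is split off the domain in \<open>card_Hom_rank\<close>. The
  link with \<open>q_binomial\<close> is made in \<open>q_binomial_eq\<close>.\<close>

fun qbin :: "nat \<Rightarrow> nat \<Rightarrow> nat \<Rightarrow> nat" where
  "qbin q a 0 = 1"
| "qbin q 0 (Suc b) = 0"
| "qbin q (Suc a) (Suc b) = q ^ Suc b * qbin q a (Suc b) + qbin q a b"

lemma qfall_Suc: "qfall q a (Suc b) = qfall q a b * (q ^ a - q ^ b)"
  by (simp add: qfall_def)

lemma qfall_0 [simp]: "qfall q a 0 = 1"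
  by (simp add: qfall_def)

lemma qfall_eq_0: "a < b \<Longrightarrow> qfall q a b = 0"
  by (auto simp: qfall_def)

lemma qfall_pos: "1 < q \<Longrightarrow> b \<le> a \<Longrightarrow> 0 < qfall q a b"
  by (auto simp: qfall_def intro!: prod_pos power_strict_increasing)

lemma qfall_shift: "(\<Prod>t<b. q ^ (a + i) - q ^ (t + i)) = q ^ (i * b) * qfall q a b"
proof -
  have "(\<Prod>t<b. q ^ (a + i) - q ^ (t + i)) = (\<Prod>t<b. q ^ i * (q ^ a - q ^ t))"
    by (simp add: diff_mult_distrib2 power_add mult.commute)
  then show ?thesis
    by (simp add: qfall_def prod.distrib power_mult)
qed

text \<open>The factors from index \<open>i\<close> on are divisible by \<open>q ^ i\<close>, and
  dividing it out leaves the product for dimension \<open>d\<close>. Used both for the exponents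
  below and for the symmetry of Gaussian binomials.\<close>

lemma qfall_add: "qfall q (i + d) (i + b) = qfall q (i + d) i * q ^ (i * b) * qfall q d b"
proof -
  have "qfall q (i + d) (i + b) = qfall q (i + d) i * (\<Prod>t<b. q ^ (d + i) - q ^ (t + i))"
    by (induction b) (simp_all add: qfall_Suc add.commute)
  then show ?thesis by (simp add: qfall_shift)
qed

lemma qfall_Suc_Suc: "qfall q (Suc a) (Suc b) = (q ^ Suc a - 1) * q ^ b * qfall q a b"
  using qfall_add[of q 1 a b] by (simp add: qfall_Suc)

text \<open>The quotient formula for Gaussian binomials without division. The induction step
  compares the Pascal rule with (q^(a+1) - 1) q^b = q^(b+1) (q^a - q^b) + (q^(b+1) - 1) q^b.\<close>

lemma qbin_qfall:
  assumes "1 < q"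
  shows "qbin q a b * qfall q b b = qfall q a b"
  using assms
proof (induction q a b rule: qbin.induct)
  case (3 q a b)
  have "qbin q (Suc a) (Suc b) * qfall q (Suc b) (Suc b) =
      q ^ Suc b * (qbin q a (Suc b) * qfall q (Suc b) (Suc b)) +
      qbin q a b * ((q ^ Suc b - 1) * q ^ b * qfall q b b)"
    by (simp only: qbin.simps qfall_Suc_Suc add_mult_distrib add_mult_distrib2 mult_ac)
  also have "\<dots> = q ^ Suc b * qfall q a (Suc b) + (q ^ Suc b - 1) * q ^ b * (qbin q a b * qfall q b b)"
    using 3 by simp
  also have "\<dots> = qfall q a b * (q ^ Suc b * (q ^ a - q ^ b) + (q ^ Suc b - 1) * q ^ b)"
    using 3 by (simp only: qfall_Suc add_mult_distrib add_mult_distrib2 mult_ac)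
  also have "\<dots> = qfall q (Suc a) (Suc b)"
  proof (cases "b \<le> a")
    case True
    have 1: "q ^ b \<le> q ^ a" "1 \<le> q ^ Suc b" "1 \<le> q ^ Suc a"
      using 3(3) True by (auto intro: power_increasing one_le_power)
    have "int (q ^ Suc b * (q ^ a - q ^ b) + (q ^ Suc b - 1) * q ^ b) = int ((q ^ Suc a - 1) * q ^ b)"
      using 1 by (simp add: of_nat_diff algebra_simps)
    then have "q ^ Suc b * (q ^ a - q ^ b) + (q ^ Suc b - 1) * q ^ b = (q ^ Suc a - 1) * q ^ b"
      by (simp only: of_nat_eq_iff)
    then show ?thesis by (simp add: qfall_Suc_Suc)
  \<comment> \<open>For \<open>a < b\<close> the difference of powers truncates, but then both sides
    vanish.\<close>
  qed (simp add: qfall_eq_0)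
  finally show ?case .
qed (simp_all add: qfall_eq_0)

text \<open>Origin of the exponents mu_j^2 - mu_j: with \<open>i\<close> the next part and
  \<open>i + d\<close> the dimension of the complement, the left side collects the factors of one
  reduction step in \<open>card_Hom_profile\<close>, and (i + d) i + d exceeds (i + d) + i d by i^2
  - i.\<close>

lemma qfall_exponents:
  "qfall q (i + d) i * q ^ ((i + d) * i) * (q ^ d * qfall q d d) =
    q ^ (i + d) * qfall q (i + d) (i + d) * q ^ (i\<^sup>2 - i)"
proof -
  have "i \<le> i\<^sup>2" by (simp add: power2_eq_square)
  then have "(i + d) * i + d = (i + d) + i * d + (i\<^sup>2 - i)"
    by (simp add: power2_eq_square add_mult_distrib add_mult_distrib2 mult.commute)
  then have "q ^ ((i + d) * i + d) = q ^ ((i + d) + i * d + (i\<^sup>2 - i))"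
    by (rule arg_cong)
  then have e: "q ^ ((i + d) * i) * q ^ d = q ^ (i + d) * q ^ (i * d) * q ^ (i\<^sup>2 - i)"
    by (simp only: power_add)
  have "qfall q (i + d) i * q ^ ((i + d) * i) * (q ^ d * qfall q d d) =
      qfall q (i + d) i * qfall q d d * (q ^ ((i + d) * i) * q ^ d)"
    by (simp only: mult_ac)
  then show ?thesis
    unfolding qfall_add[of q i d d] e by (simp only: mult_ac)
qed

lemma qfall_shift_1:
  "(\<Prod>i\<in>{0<..c}. q ^ Suc m - q ^ i) = q ^ c * qfall q m c"
proof -
  have "(\<Prod>i\<in>{0<..c}. q ^ Suc m - q ^ i) = (\<Prod>t<c. q ^ (m + 1) - q ^ (t + 1))"
    by (rule prod.reindex_bij_witness[where i = Suc and j = "\<lambda>i. i - 1"]) auto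
  then show ?thesis unfolding qfall_shift by simp
qed

text \<open>The number b(mu) of the overview, with parts indexed from \<open>0\<close> and with
  \<open>N\<close> standing for a bound beyond which all parts vanish.\<close>

definition profile_factor :: "nat \<Rightarrow> nat \<Rightarrow> (nat \<Rightarrow> nat) \<Rightarrow> nat" where
  "profile_factor q N \<nu> = (\<Prod>i<N. qbin q (\<nu> i) (\<nu> (Suc i)) * q ^ ((\<nu> (Suc i))\<^sup>2 - \<nu> (Suc i)))"

lemma profile_factor_Suc: "profile_factor q (Suc N) \<nu> =
    qbin q (\<nu> 0) (\<nu> 1) * q ^ ((\<nu> 1)\<^sup>2 - \<nu> 1) * profile_factor q N (\<lambda>i. \<nu> (Suc i))"
  unfolding profile_factor_def by (subst prod.lessThan_Suc_shift) simp

section \<open>Counting subspaces\<close>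

lemma card_field_gt_1: "1 < CARD('a::{field,finite})"
proof -
  have "card {0, 1 :: 'a} \<le> CARD('a)"
    by (rule card_mono) auto
  then show ?thesis by simp
qed

text \<open>Finiteness is asked of individual subspaces and not of the vector type, so that the
  results also apply to \<open>coord_space\<close>, which lives in the infinite type of functions on
  \<open>nat\<close>.\<close>

locale vector_space_over_finite = vector_space scale
  for scale :: "'a::{field,finite} \<Rightarrow> 'b::ab_group_add \<Rightarrow> 'b" +
  fixes q :: nat
  assumes card_scalars: "CARD('a) = q"
begin

lemma q_gt_1: "1 < q"
  using card_field_gt_1 card_scalars by metis

lemma q_gt_0 [simp]: "0 < q"
  using q_gt_1 by linarith

lemma card_span:
  assumes "finite B" "independent B"
  shows "finite (span B) \<and> card (span B) = q ^ card B"
  using assms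
proof (induction B rule: finite_induct)
  case (insert x B)
  then have ind: "independent B" and x: "x \<notin> span B"
    by (auto simp: independent_insert split: if_splits)
  have eq: "span (insert x B) = (\<lambda>(k, y). scale k x + y) ` (UNIV \<times> span B)"
  proof (intro subset_antisym subsetI)
    fix y assume "y \<in> span (insert x B)"
    then obtain k where "y - scale k x \<in> span B"
      by (auto simp: span_insert)
    then show "y \<in> (\<lambda>(k, y). scale k x + y) ` (UNIV \<times> span B)"
      by (intro image_eqI[of _ _ "(k, y - scale k x)"]) auto
  next
    fix y assume "y \<in> (\<lambda>(k, y). scale k x + y) ` (UNIV \<times> span B)"
    then obtain k z where "z \<in> span B" "y = scale k x + z"
      by auto
    then show "y \<in> span (insert x B)"
      unfolding span_insert by (auto intro!: exI[of _ k])
  qed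
  have inj: "inj_on (\<lambda>(k, y). scale k x + y) (UNIV \<times> span B)"
  proof (rule inj_onI, clarify)
    fix k y k' y'
    assume y: "y \<in> span B" "y' \<in> span B" and e: "scale k x + y = scale k' x + y'"
    have "scale (k - k') x = y' - y"
      using e by (simp add: algebra_simps)
    then have *: "scale (k - k') x \<in> span B"
      using y by (simp add: span_diff)
    have "k = k'"
    proof (rule ccontr)
      assume "k \<noteq> k'"
      then have "scale (inverse (k - k')) (scale (k - k') x) = x"
        by simp
      then show False
        using x span_scale[OF *] by metis
    qed
    then show "k = k' \<and> y = y'" using e by simp
  qed
  show ?case
    using insert.IH[OF ind] insert.hyps
    by (simp add: eq card_image[OF inj] card_cartesian_product card_scalars)
qed simp

lemma card_subspace:
  assumes "subspace U" "finite U"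
  shows "card U = q ^ dim U"
proof -
  obtain B where B: "B \<subseteq> U" "independent B" "U \<subseteq> span B" "card B = dim U"
    by (rule basis_exists)
  moreover have "span B = U"
    using B assms by (simp add: span_subspace)
  ultimately show ?thesis
    using card_span[of B] assms finite_subset[of B U] by auto
qed

lemma dim_eqI:
  assumes "subspace U" "finite U" "card U = q ^ d"
  shows "dim U = d"
  using card_subspace[OF assms(1,2)] assms(3) q_gt_1 by simp

lemma card_subspace_remainder:
  assumes "subspace U" "finite V" "U \<subseteq> V"
  shows "card (V - U) = card V - q ^ dim U"
  using assms card_subspace[of U] by (simp add: card_Diff_subset finite_subset)

definition indep_lists :: "nat \<Rightarrow> 'b set \<Rightarrow> 'b list set" where
  "indep_lists b U = {xs. length xs = b \<and> distinct xs \<and> independent (set xs) \<and> set xs \<subseteq> U}"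

lemma finite_indep_lists: "finite U \<Longrightarrow> finite (indep_lists b U)"
  by (rule finite_subset[OF _ finite_lists_length_eq[of U b]]) (auto simp: indep_lists_def)

text \<open>A list is extended by any vector outside the span of its entries, and after
  \<open>t\<close> steps that span has \<open>q ^ t\<close> elements.\<close>

lemma card_indep_lists:
  assumes "subspace U" "finite U"
  shows "card (indep_lists b U) = (\<Prod>t<b. q ^ dim U - q ^ t)"
proof (induction b)
  case 0
  have "indep_lists 0 U = {[]}"
    by (auto simp: indep_lists_def independent_empty)
  then show ?case by simp
next
  case (Suc b)
  have eq: "indep_lists (Suc b) U = (\<lambda>(xs, x). x # xs) ` (SIGMA xs:indep_lists b U. U - span (set xs))"
    by (auto simp: indep_lists_def image_iff length_Suc_conv independent_insert span_base
        dest: dependent_insertD)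
  have inj: "inj_on (\<lambda>(xs, x). x # xs) (SIGMA xs:indep_lists b U. U - span (set xs))"
    by (auto simp: inj_on_def)
  have each: "card (U - span (set xs)) = q ^ dim U - q ^ b" if "xs \<in> indep_lists b U" for xs
  proof -
    have "span (set xs) \<subseteq> U" "dim (span (set xs)) = b"
      using that assms(1)
      by (auto simp: indep_lists_def span_minimal dim_eq_card_independent distinct_card)
    then show ?thesis
      using card_subspace_remainder[of "span (set xs)" U] assms by (simp add: card_subspace)
  qed
  show ?case
    using Suc each assms
    by (simp add: eq card_image[OF inj] card_SigmaI finite_indep_lists)
qed

lemma dim_le_of_subset:
  assumes "subspace U" "subspace V" "finite V" "U \<subseteq> V"
  shows "dim U \<le> dim V"
  using card_mono[OF assms(3,4)] card_subspace[OF assms(1)] card_subspace[OF assms(2)] assms q_gt_1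
  by (simp add: finite_subset)

lemma subspace_eq_of_dim:
  assumes "subspace U" "subspace V" "finite V" "U \<subseteq> V" "dim U = dim V"
  shows "U = V"
  using card_subset_eq[OF assms(3,4)] card_subspace[of U] card_subspace[of V] assms
  by (simp add: finite_subset)

lemma indep_lists_span:
  assumes "subspace U" "finite U" "xs \<in> indep_lists (dim U) U"
  shows "span (set xs) = U"
  using assms
  by (intro subspace_eq_of_dim)
    (auto simp: indep_lists_def span_minimal dim_eq_card_independent distinct_card)

text \<open>The independent lists of length \<open>b\<close> in \<open>V\<close> are grouped by
  their span; each class consists of the ordered bases of one subspace.\<close>

lemma card_subspaces:
  assumes "subspace V" "finite V"
  shows "card {U. subspace U \<and> U \<subseteq> V \<and> dim U = b} * (\<Prod>t<b. q ^ b - q ^ t) = (\<Prod>t<b. q ^ dim V - q ^ t)"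
proof -
  let ?S = "{U. subspace U \<and> U \<subseteq> V \<and> dim U = b}"
  have fin: "finite ?S"
    by (rule finite_subset[of _ "Pow V"]) (use assms in auto)
  have eq: "indep_lists b V = (\<Union>U\<in>?S. indep_lists b U)"
  proof (intro subset_antisym subsetI)
    fix xs assume "xs \<in> indep_lists b V"
    then have "xs \<in> indep_lists b (span (set xs))" "span (set xs) \<in> ?S"
      using assms(1)
      by (auto simp: indep_lists_def span_superset span_minimal dim_eq_card_independent distinct_card)
    then show "xs \<in> (\<Union>U\<in>?S. indep_lists b U)" by blast
  qed (auto simp: indep_lists_def)
  have "card (indep_lists b V) = (\<Sum>U\<in>?S. card (indep_lists b U))"
    unfolding eq
  proof (rule card_UN_disjoint[OF fin])
    show "\<forall>U\<in>?S. finite (indep_lists b U)"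
      using assms by (auto intro: finite_indep_lists finite_subset)
    show "\<forall>i\<in>?S. \<forall>j\<in>?S. i \<noteq> j \<longrightarrow> indep_lists b i \<inter> indep_lists b j = {}"
    proof (intro ballI impI)
      fix U U' assume U: "U \<in> ?S" "U' \<in> ?S" "U \<noteq> U'"
      then have "finite U" "finite U'"
        using assms(2) by (auto intro: finite_subset)
      then show "indep_lists b U \<inter> indep_lists b U' = {}"
        using U indep_lists_span[of U] indep_lists_span[of U'] by auto
    qed
  qed
  also have "\<dots> = (\<Sum>U\<in>?S. \<Prod>t<b. q ^ b - q ^ t)"
    using assms by (intro sum.cong) (auto simp: card_indep_lists finite_subset)
  finally show ?thesis
    using card_indep_lists[OF assms] by simp
qed

end

section \<open>Direct sums and spaces of linear maps\<close>

text \<open>Fibrewise counting, to be fed with the bijections that split a linear map by domain or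
  by codomain.\<close>

lemma card_prod_bij:
  assumes "bij_betw F (S \<times> T) U" "finite S" "finite T"
  shows "card {u \<in> U. P u} = (\<Sum>s\<in>S. card {t \<in> T. P (F (s, t))})"
proof -
  have "bij_betw F (SIGMA s:S. {t \<in> T. P (F (s, t))}) {u \<in> U. P u}"
    using assms(1) by (auto simp: bij_betw_def inj_on_def image_iff)
  from bij_betw_same_card[OF this] show ?thesis
    using assms(2,3) by (simp add: card_SigmaI)
qed

locale finite_vector_space = vector_space_over_finite scale q
  for scale :: "'a::{field,finite} \<Rightarrow> 'b::{ab_group_add,finite} \<Rightarrow> 'b" and q :: nat
begin

sublocale pair: vector_space_pair scale scale ..

lemma subspace_plus: "subspace A \<Longrightarrow> subspace B \<Longrightarrow> subspace (A + B)"
  using subspace_sums[of A B] by (simp add: set_plus_def Bex_def conj_ac cong: conj_cong)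

lemma plus_superset1: "subspace B \<Longrightarrow> A \<subseteq> A + B"
  using set_zero_plus2[of B A] by (simp add: subspace_0 add.commute)

lemma plus_superset2: "subspace A \<Longrightarrow> B \<subseteq> A + B"
  using set_zero_plus2[of A B] by (simp add: subspace_0)

lemma plus_least: "subspace C \<Longrightarrow> A \<subseteq> C \<Longrightarrow> B \<subseteq> C \<Longrightarrow> A + B \<subseteq> C"
  by (auto elim!: set_plus_elim intro: subspace_add)

lemma plus_absorb: "subspace A \<Longrightarrow> subspace B \<Longrightarrow> B \<subseteq> A \<Longrightarrow> A + B = A"
  by (simp add: antisym plus_least plus_superset1)

definition direct :: "'b set \<Rightarrow> 'b set \<Rightarrow> bool" where
  "direct A B \<longleftrightarrow> subspace A \<and> subspace B \<and> A \<inter> B = {0}"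

lemma directI: "subspace A \<Longrightarrow> subspace B \<Longrightarrow> A \<inter> B \<subseteq> {0} \<Longrightarrow> direct A B"
  using subspace_0 by (fastforce simp: direct_def)

lemma direct_subspace: "direct A B \<Longrightarrow> subspace A" "direct A B \<Longrightarrow> subspace B"
  "direct A B \<Longrightarrow> subspace (A + B)"
  by (auto simp: direct_def subspace_plus)

lemma direct_commute: "direct A B \<longleftrightarrow> direct B A"
  by (auto simp: direct_def)

lemma direct_mono: "direct A B \<Longrightarrow> subspace A' \<Longrightarrow> subspace B' \<Longrightarrow> A' \<subseteq> A \<Longrightarrow> B' \<subseteq> B \<Longrightarrow> direct A' B'"
  by (rule directI) (auto simp: direct_def)

lemma direct_unique:
  assumes "direct A B" "a \<in> A" "a' \<in> A" "b \<in> B" "b' \<in> B" "a + b = a' + b'"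
  shows "a = a' \<and> b = b'"
proof -
  have "a - a' = b' - b" using assms(6) by (simp add: algebra_simps)
  moreover have "a - a' \<in> A" "b' - b \<in> B"
    using assms by (auto simp: direct_def subspace_diff)
  ultimately have "a - a' \<in> A \<inter> B" by auto
  then have "a - a' = 0" using assms(1) unfolding direct_def by blast
  then show ?thesis using assms(6) by simp
qed

lemma direct_assoc:
  assumes "direct A B" "direct (A + B) C"
  shows "direct B C" "direct A (B + C)"
proof -
  have s: "subspace A" "subspace B" "subspace C"
    using assms by (auto simp: direct_def)
  show "direct B C"
    using direct_mono[OF assms(2) s(2,3)] s by (simp add: plus_superset2)
  show "direct A (B + C)"
  proof (rule directI)
    show "A \<inter> (B + C) \<subseteq> {0}"
    proof
      fix x assume x: "x \<in> A \<inter> (B + C)"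
      then obtain b c where bc: "b \<in> B" "c \<in> C" "x = b + c"
        by (auto elim: set_plus_elim)
      have "x + (- b) \<in> A + B"
        using x bc s by (intro set_plus_intro subspace_neg) auto
      then have "c \<in> A + B" using bc by simp
      then have "c = 0" using bc assms(2) by (auto simp: direct_def)
      then show "x \<in> {0}" using x bc assms(1) by (auto simp: direct_def)
    qed
  qed (use s in \<open>auto intro: subspace_plus\<close>)
qed

lemma direct_assoc_left:
  assumes "direct B C" "direct A (B + C)"
  shows "direct A B" "direct (A + B) C"
  using direct_assoc[of C B A] assms by (simp_all add: direct_commute add.commute)

lemma card_plus: "direct A B \<Longrightarrow> card (A + B) = card A * card B"
  unfolding set_plus_image card_cartesian_product[symmetric]
  by (rule card_image) (auto simp: inj_on_def dest: direct_unique)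

lemma card_eq_power_dim: "subspace U \<Longrightarrow> card U = q ^ dim U"
  by (simp add: card_subspace)

lemma dim_plus:
  assumes "direct A B"
  shows "dim (A + B) = dim A + dim B"
  using assms card_plus[OF assms] card_eq_power_dim[of A] card_eq_power_dim[of B]
  by (intro dim_eqI) (auto simp: direct_subspace power_add)

lemma dim_mono_subspace: "subspace U \<Longrightarrow> subspace V \<Longrightarrow> U \<subseteq> V \<Longrightarrow> dim U \<le> dim V"
  by (rule dim_le_of_subset) auto

lemma subspace_dim_equal: "subspace U \<Longrightarrow> subspace V \<Longrightarrow> U \<subseteq> V \<Longrightarrow> dim U = dim V \<Longrightarrow> U = V"
  by (rule subspace_eq_of_dim) auto

lemma dim_zero_space [simp]: "dim {0} = 0"
  by (rule dim_eqI) auto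

lemma dim_eq_0_iff:
  assumes "subspace U"
  shows "dim U = 0 \<longleftrightarrow> U = {0}"
proof
  assume "dim U = 0"
  then have "card U = 1" using card_eq_power_dim[OF assms] by simp
  then show "U = {0}" using subspace_0[OF assms] by (auto simp: card_1_singleton_iff)
qed simp

lemma dim_line: "w \<noteq> 0 \<Longrightarrow> dim (span {w}) = 1"
  by (subst dim_span_eq_card_independent) auto

lemma exists_complement:
  assumes "subspace A" "subspace S" "A \<subseteq> S"
  shows "\<exists>B. direct A B \<and> A + B = S"
proof -
  obtain E where E: "E \<subseteq> A" "independent E" "A \<subseteq> span E"
    using maximal_independent_subset by blast
  then obtain F where F: "E \<subseteq> F" "F \<subseteq> S" "independent F" "S \<subseteq> span F"
    using maximal_independent_subset_extend[of E S] assms(3) by blast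
  have spanE: "span E = A" and spanF: "span F = S"
    using span_subspace[OF E(1,3) assms(1)] span_subspace[OF F(2,4) assms(2)] .
  let ?B = "span (F - E)"
  have sum: "A + ?B = S"
    using span_Un[of E "F - E"] F(1) spanE spanF
    by (auto simp: set_plus_def Un_absorb1 Bex_def) 
  have "A \<inter> ?B \<subseteq> {0}"
  proof
    fix x assume x: "x \<in> A \<inter> ?B"
    \<comment> \<open>A vector of both spans has one representation over \<open>F\<close>, supported
      in \<open>E\<close> and also in \<open>F - E\<close>, hence zero.\<close>
    have "representation F x = representation E x" "representation F x = representation (F - E) x"
      using x spanE F by (auto intro!: representation_extend)
    then have "representation F x = (\<lambda>_. 0)"
      by (metis Diff_iff ext representation_ne_zero)
    moreover have "x \<in> span F" using x spanF assms by auto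
    ultimately show "x \<in> {0}"
      using sum_nonzero_representation_eq[OF F(3), of x] by simp
  qed
  then show ?thesis
    using sum assms by (auto intro!: exI[of _ ?B] directI)
qed

section \<open>Linear maps on subspaces and projections along a complement\<close>

definition linear_on :: "'b set \<Rightarrow> ('b \<Rightarrow> 'b) \<Rightarrow> bool" where
  "linear_on A f \<longleftrightarrow> (\<forall>x\<in>A. \<forall>y\<in>A. f (x + y) = f x + f y) \<and> (\<forall>c. \<forall>x\<in>A. f (scale c x) = scale c (f x))"

lemma linear_on_add: "linear_on A f \<Longrightarrow> x \<in> A \<Longrightarrow> y \<in> A \<Longrightarrow> f (x + y) = f x + f y"
  and linear_on_scale: "linear_on A f \<Longrightarrow> x \<in> A \<Longrightarrow> f (scale c x) = scale c (f x)"
  by (auto simp: linear_on_def)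

lemma linear_on_0: "linear_on A f \<Longrightarrow> subspace A \<Longrightarrow> f 0 = 0"
  using linear_on_scale[of A f 0 0] by (simp add: subspace_0)

lemma linear_on_diff: "linear_on A f \<Longrightarrow> subspace A \<Longrightarrow> x \<in> A \<Longrightarrow> y \<in> A \<Longrightarrow> f (x - y) = f x - f y"
  using linear_on_add[of A f "x - y" y] by (simp add: subspace_diff)

lemma linear_on_subset: "linear_on A f \<Longrightarrow> B \<subseteq> A \<Longrightarrow> linear_on B f"
  unfolding linear_on_def by (meson subsetD)

lemma linear_on_cong: "subspace A \<Longrightarrow> (\<And>x. x \<in> A \<Longrightarrow> f x = g x) \<Longrightarrow> linear_on A f = linear_on A g"
  by (simp add: linear_on_def subspace_add subspace_scale)

lemma linear_on_plus: "linear_on A f \<Longrightarrow> linear_on A g \<Longrightarrow> linear_on A (\<lambda>x. f x + g x)"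
  by (simp add: linear_on_def algebra_simps scale_right_distrib)

lemma linear_on_minus: "linear_on A f \<Longrightarrow> linear_on A g \<Longrightarrow> linear_on A (\<lambda>x. f x - g x)"
  by (simp add: linear_on_def algebra_simps scale_right_diff_distrib)

lemma linear_on_comp: "linear_on A f \<Longrightarrow> f ` A \<subseteq> B \<Longrightarrow> linear_on B g \<Longrightarrow> linear_on A (\<lambda>x. g (f x))"
  by (auto simp: linear_on_def image_subset_iff)

lemma linear_imp_linear_on: "Vector_Spaces.linear scale scale f \<Longrightarrow> linear_on A f"
  by (simp add: linear_on_def pair.linear_add pair.linear_scale)

lemma subspace_lin_image:
  assumes f: "linear_on A f" and B: "subspace B" "B \<subseteq> A"
  shows "subspace (f ` B)"
proof (rule subspaceI)
  show "0 \<in> f ` B"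
    using linear_on_0[OF linear_on_subset[OF f B(2)] B(1)] subspace_0[OF B(1)] by (metis imageI)
  show "x + y \<in> f ` B" if xy: "x \<in> f ` B" "y \<in> f ` B" for x y
  proof -
    obtain a b where "a \<in> B" "b \<in> B" "x = f a" "y = f b" using xy by blast
    then show ?thesis
      using linear_on_add[OF f, of a b] B subspace_add[OF B(1), of a b] by (metis imageI subsetD)
  qed
  show "scale c x \<in> f ` B" if x: "x \<in> f ` B" for c x
  proof -
    obtain a where "a \<in> B" "x = f a" using x by blast
    then show ?thesis
      using linear_on_scale[OF f, of a c] B subspace_scale[OF B(1), of a c] by (metis imageI subsetD)
  qed
qed

lemma subspace_lin_kernel: "linear_on A f \<Longrightarrow> subspace A \<Longrightarrow> subspace {x \<in> A. f x = 0}"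
  using linear_on_0[of A f] by (auto simp: subspace_def linear_on_def)

lemma dim_lin_image_inj:
  assumes "linear_on A f" "subspace A" "\<And>x. x \<in> A \<Longrightarrow> f x = 0 \<Longrightarrow> x = 0"
  shows "dim (f ` A) = dim A" "inj_on f A"
proof -
  show inj: "inj_on f A"
  proof (rule inj_onI)
    fix x y assume "x \<in> A" "y \<in> A" "f x = f y"
    then show "x = y"
      using assms linear_on_diff[of A f x y] subspace_diff[of A x y] by force
  qed
  show "dim (f ` A) = dim A"
    using assms card_eq_power_dim[of A] card_image[OF inj] by (intro dim_eqI subspace_lin_image) auto
qed

lemma lin_image_plus:
  assumes f: "linear_on (A + B) f" and s: "subspace A" "subspace B"
  shows "f ` (A + B) = f ` A + f ` B"
proof -
  have "f (a + b) = f a + f b" if "a \<in> A" "b \<in> B" for a b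
    using that linear_on_add[OF f] plus_superset1[OF s(2), of A] plus_superset2[OF s(1), of B] by blast
  then have "(\<lambda>(a, b). f (a + b)) ` (A \<times> B) = (\<lambda>(a, b). f a + f b) ` (A \<times> B)"
    by (intro image_cong) auto
  also have "\<dots> = (\<lambda>(x, y). x + y) ` (f ` A \<times> f ` B)"
    by (auto simp: image_iff)
  finally show ?thesis
    by (simp add: set_plus_image image_image case_prod_unfold)
qed

definition proj :: "'b set \<Rightarrow> 'b set \<Rightarrow> 'b \<Rightarrow> 'b" where
  "proj A B x = (THE a. a \<in> A \<and> x - a \<in> B)"

lemma proj_eq:
  assumes "direct A B" "a \<in> A" "b \<in> B"
  shows "proj A B (a + b) = a"
  unfolding proj_def
proof (rule the_equality)
  fix a' assume "a' \<in> A \<and> a + b - a' \<in> B"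
  then show "a' = a"
    using direct_unique[of A B a a' b "a + b - a'"] assms by auto
qed (use assms in auto)

lemma proj_mem: "direct A B \<Longrightarrow> x \<in> A + B \<Longrightarrow> proj A B x \<in> A"
  and proj_add_proj: "direct A B \<Longrightarrow> x \<in> A + B \<Longrightarrow> proj A B x + proj B A x = x"
  using proj_eq[of A B] proj_eq[of B A]
  by (force elim!: set_plus_elim simp: direct_commute[of B A] add.commute)+

lemma proj_left: "direct A B \<Longrightarrow> a \<in> A \<Longrightarrow> proj A B a = a"
  using proj_eq[of A B a 0] by (simp add: direct_def subspace_0)

lemma proj_right: "direct A B \<Longrightarrow> b \<in> B \<Longrightarrow> proj A B b = 0"
  using proj_eq[of A B 0 b] by (simp add: direct_def subspace_0)

lemma linear_on_proj: 
  assumes "direct A B"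
  shows "linear_on (A + B) (proj A B)"
proof -
  have s: "subspace A" "subspace B" using assms by (auto simp: direct_def)
  have "proj A B ((a + b) + (a' + b')) = a + a'" if "a \<in> A" "b \<in> B" "a' \<in> A" "b' \<in> B" for a b a' b'
    using proj_eq[OF assms, of "a + a'" "b + b'"] that s by (simp add: subspace_add algebra_simps)
  moreover have "proj A B (scale c (a + b)) = scale c a" if "a \<in> A" "b \<in> B" for a b c
    using proj_eq[OF assms, of "scale c a" "scale c b"] that s by (simp add: subspace_scale scale_right_distrib)
  ultimately show ?thesis
    unfolding linear_on_def by (auto elim!: set_plus_elim simp: proj_eq[OF assms])
qed

text \<open>Extensionality makes each linear map on a subspace a single function of the full type,
  so that sets of maps can be counted.\<close>

definition Hom :: "'b set \<Rightarrow> 'b set \<Rightarrow> ('b \<Rightarrow> 'b) set" where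
  "Hom A B = {f \<in> A \<rightarrow>\<^sub>E B. linear_on A f}"

lemma finite_Hom [simp]: "finite (Hom A B)"
  by (rule finite_subset[OF _ finite_PiE[of A "\<lambda>_. B"]]) (auto simp: Hom_def)

lemma HomD: "f \<in> Hom A B \<Longrightarrow> linear_on A f" "f \<in> Hom A B \<Longrightarrow> f ` A \<subseteq> B"
  "f \<in> Hom A B \<Longrightarrow> x \<in> A \<Longrightarrow> f x \<in> B"
  by (auto simp: Hom_def)

lemma restrict_in_Hom: "subspace A \<Longrightarrow> linear_on A f \<Longrightarrow> f ` A \<subseteq> B \<Longrightarrow> restrict f A \<in> Hom A B"
  using linear_on_cong[of A "restrict f A" f] by (auto simp: Hom_def)

lemma restrict_in_HomI: "subspace A \<Longrightarrow> linear_on A f \<Longrightarrow> (\<And>x. x \<in> A \<Longrightarrow> f x \<in> B) \<Longrightarrow> restrict f A \<in> Hom A B"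
  by (rule restrict_in_Hom) auto

lemma Hom_eqI: "f \<in> Hom A B \<Longrightarrow> g \<in> Hom A C \<Longrightarrow> (\<And>x. x \<in> A \<Longrightarrow> f x = g x) \<Longrightarrow> f = g"
  unfolding Hom_def PiE_def by (blast intro: extensionalityI)

lemma linear_on_span_eq:
  assumes "linear_on (span B) f" "linear_on (span B) g" "\<And>x. x \<in> B \<Longrightarrow> f x = g x" "x \<in> span B"
  shows "f x = g x"
proof -
  have "x \<in> span B \<and> f x = g x"
    using assms(4)
  proof (induction rule: span_induct_alt)
    case base
    show ?case using assms(1,2) linear_on_0[OF _ subspace_span] by (metis span_zero)
  next
    case (step c x y)
    then have "x \<in> span B" "scale c x \<in> span B" by (simp_all add: span_scale span_base)
    then show ?case
      using step assms by (simp add: linear_on_add[of "span B"] linear_on_scale[of "span B"] span_add)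
  qed
  then show ?thesis by simp
qed

lemma bij_betw_Hom_basis:
  assumes "independent B" "subspace X"
  shows "bij_betw (\<lambda>f. restrict f B) (Hom (span B) X) (B \<rightarrow>\<^sub>E X)"
proof (rule bij_betw_imageI)
  show "inj_on (\<lambda>f. restrict f B) (Hom (span B) X)"
  proof (rule inj_onI)
    fix f g assume *: "f \<in> Hom (span B) X" "g \<in> Hom (span B) X" "restrict f B = restrict g B"
    then have eq: "f x = g x" if "x \<in> B" for x
      using that by (metis restrict_apply')
    show "f = g"
      using *(1,2) HomD(1)[OF *(1)] HomD(1)[OF *(2)] eq linear_on_span_eq[of B f g] by (blast intro: Hom_eqI)
  qed
  show "(\<lambda>f. restrict f B) ` Hom (span B) X = B \<rightarrow>\<^sub>E X"
  proof (intro subset_antisym subsetI)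
    fix g assume g: "g \<in> B \<rightarrow>\<^sub>E X"
    obtain h where h: "Vector_Spaces.linear scale scale h" "\<forall>x\<in>B. h x = g x"
      using pair.linear_independent_extend[OF assms(1)] by blast
    have "h ` span B = span (h ` B)"
      using h(1) by (simp add: pair.linear_span_image)
    also have "\<dots> \<subseteq> X"
      using g h assms(2) by (intro span_minimal) auto
    finally have "restrict h (span B) \<in> Hom (span B) X"
      using h(1) by (intro restrict_in_Hom) (auto intro: linear_imp_linear_on)
    moreover have "restrict (restrict h (span B)) B = g"
    proof (rule extensionalityI[of _ B])
      show "g \<in> extensional B" using g by (simp add: PiE_def)
      show "restrict (restrict h (span B)) B x = g x" if "x \<in> B" for x
        using that h(2) by (simp add: span_base)
    qed (rule restrict_extensional)
    ultimately show "g \<in> (\<lambda>f. restrict f B) ` Hom (span B) X"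
      by (metis image_eqI)
  next
    fix g assume "g \<in> (\<lambda>f. restrict f B) ` Hom (span B) X"
    then show "g \<in> B \<rightarrow>\<^sub>E X"
      using HomD(3)[of _ "span B" X] span_base[of _ B] by (auto simp del: span_eq_iff)
  qed
qed

lemma card_Hom:
  assumes "subspace A" "subspace X"
  shows "card (Hom A X) = q ^ (dim A * dim X)"
proof -
  obtain B where B: "B \<subseteq> A" "independent B" "A \<subseteq> span B" "card B = dim A"
    by (rule basis_exists)
  then have "span B = A" using span_subspace[OF B(1,3) assms(1)] by simp
  then have "card (Hom A X) = card (B \<rightarrow>\<^sub>E X)"
    using bij_betw_same_card[OF bij_betw_Hom_basis[OF B(2) assms(2)]] by simp
  then show ?thesis
    using B assms by (simp add: card_PiE card_eq_power_dim power_mult[symmetric] mult.commute)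
qed

lemma bij_betw_Hom_line:
  assumes "w \<noteq> 0" "subspace X"
  shows "bij_betw (\<lambda>f. f w) (Hom (span {w}) X) X"
proof -
  have 1: "bij_betw (\<lambda>f. f w) ({w} \<rightarrow>\<^sub>E X) X"
  proof (rule bij_betw_byWitness[where f' = "\<lambda>x. restrict (\<lambda>_. x) {w}"])
  qed (auto simp: PiE_def extensional_def fun_eq_iff)
  show ?thesis
    using bij_betw_trans[OF bij_betw_Hom_basis[of "{w}" X] 1] assms by (simp add: o_def)
qed

section \<open>Splitting linear maps along direct sums of the domain or the codomain\<close>

definition glue :: "'b set \<Rightarrow> 'b set \<Rightarrow> ('b \<Rightarrow> 'b) \<Rightarrow> ('b \<Rightarrow> 'b) \<Rightarrow> 'b \<Rightarrow> 'b" where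
  "glue A B f g = (\<lambda>x\<in>A + B. f (proj A B x) + g (proj B A x))"

lemma glue_in_Hom:
  assumes "direct A B" "subspace X" "f \<in> Hom A X" "g \<in> Hom B X"
  shows "glue A B f g \<in> Hom (A + B) X"
  unfolding glue_def
proof (rule restrict_in_HomI)
  have d: "direct B A" using assms(1) by (simp add: direct_commute)
  have A: "linear_on (A + B) (\<lambda>x. f (proj A B x))"
    by (rule linear_on_comp[OF linear_on_proj[OF assms(1)] _ HomD(1)[OF assms(3)]])
      (use proj_mem[OF assms(1)] in blast)
  have B: "linear_on (A + B) (\<lambda>x. g (proj B A x))"
    by (rule linear_on_comp[OF linear_on_proj[OF d, unfolded add.commute[of B A]] _ HomD(1)[OF assms(4)]])
      (use proj_mem[OF d, unfolded add.commute[of B A]] in blast)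
  show "linear_on (A + B) (\<lambda>x. f (proj A B x) + g (proj B A x))"
    by (rule linear_on_plus[OF A B])
  show "f (proj A B x) + g (proj B A x) \<in> X" if "x \<in> A + B" for x
    using proj_mem[OF assms(1)] proj_mem[OF d, unfolded add.commute[of B A]] that
    by (intro subspace_add[OF assms(2)] HomD(3)[OF assms(3)] HomD(3)[OF assms(4)]) auto
qed (rule direct_subspace(3)[OF assms(1)])

lemma glue_left:
  assumes "direct A B" "g \<in> Hom B X" "x \<in> A"
  shows "glue A B f g x = f x"
proof -
  have "x \<in> A + B" "proj A B x = x" "proj B A x = 0" "g 0 = 0"
    using assms plus_superset1[of B A] proj_left[of A B x] proj_right[of B A x] linear_on_0[of B g] HomD(1)[of g B X]
    by (auto simp: direct_subspace direct_commute[of B A])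
  then show ?thesis by (simp add: glue_def)
qed

lemma glue_right:
  assumes "direct A B" "f \<in> Hom A X" "x \<in> B"
  shows "glue A B f g x = g x"
proof -
  have "x \<in> A + B" "proj B A x = x" "proj A B x = 0" "f 0 = 0"
    using assms plus_superset2[of A B] proj_left[of B A x] proj_right[of A B x] linear_on_0[of A f] HomD(1)[of f A X]
    by (auto simp: direct_subspace direct_commute[of B A])
  then show ?thesis by (simp add: glue_def)
qed

lemma Hom_extensional: "f \<in> Hom A X \<Longrightarrow> f \<in> extensional A"
  by (simp add: Hom_def PiE_def)

lemma bij_betw_glue:
  assumes "direct A B" "subspace X"
  shows "bij_betw (\<lambda>(f, g). glue A B f g) (Hom A X \<times> Hom B X) (Hom (A + B) X)"
proof (rule bij_betw_imageI)
  note s = direct_subspace[OF assms(1)]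
  have sub: "A \<subseteq> A + B" "B \<subseteq> A + B"
    using plus_superset1[OF s(2)] plus_superset2[OF s(1)] by auto
  show "inj_on (\<lambda>(f, g). glue A B f g) (Hom A X \<times> Hom B X)"
  proof (rule inj_onI, clarify)
    fix f g f' g' assume *: "f \<in> Hom A X" "g \<in> Hom B X" "f' \<in> Hom A X" "g' \<in> Hom B X"
      "glue A B f g = glue A B f' g'"
    have "f = f'"
      using glue_left[OF assms(1) *(2)] glue_left[OF assms(1) *(4)] *(5)
      by (intro Hom_eqI[OF *(1,3)]) metis
    moreover have "g = g'"
      using glue_right[OF assms(1) *(1)] glue_right[OF assms(1) *(3)] *(5)
      by (intro Hom_eqI[OF *(2,4)]) metis
    ultimately show "f = f' \<and> g = g'" ..
  qed
  show "(\<lambda>(f, g). glue A B f g) ` (Hom A X \<times> Hom B X) = Hom (A + B) X"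
  proof (intro subset_antisym subsetI)
    fix h assume h: "h \<in> Hom (A + B) X"
    have r: "restrict h A \<in> Hom A X" "restrict h B \<in> Hom B X"
      using sub HomD(3)[OF h] linear_on_subset[OF HomD(1)[OF h]] s
      by (auto intro!: restrict_in_HomI)
    note g = glue_in_Hom[OF assms r]
    have "glue A B (restrict h A) (restrict h B) x = h x" if x: "x \<in> A + B" for x
    proof -
      obtain a b where ab: "x = a + b" "a \<in> A" "b \<in> B"
        using x by (rule set_plus_elim)
      then have "a \<in> A + B" "b \<in> A + B" using sub by auto
      then show ?thesis
        using ab glue_left[OF assms(1) r(2) ab(2)] glue_right[OF assms(1) r(1) ab(3)]
        by (simp add: linear_on_add[OF HomD(1)[OF g]] linear_on_add[OF HomD(1)[OF h]])
    qed
    then have "h = glue A B (restrict h A) (restrict h B)"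
      by (intro Hom_eqI[OF h g]) simp
    then show "h \<in> (\<lambda>(f, g). glue A B f g) ` (Hom A X \<times> Hom B X)"
      using r by (intro image_eqI[of _ _ "(restrict h A, restrict h B)"]) auto
  qed (use glue_in_Hom[OF assms] in auto)
qed

lemma card_Hom_domain:
  assumes "direct A B" "subspace X"
  shows "card {h \<in> Hom (A + B) X. P h} = (\<Sum>f\<in>Hom A X. card {g \<in> Hom B X. P (glue A B f g)})"
  using card_prod_bij[OF bij_betw_glue[OF assms]] by simp

lemma bij_betw_Hom_codomain:
  assumes "subspace A" "direct X Y"
  shows "bij_betw (\<lambda>(f, g). \<lambda>x\<in>A. f x + g x) (Hom A X \<times> Hom A Y) (Hom A (X + Y))"
proof (rule bij_betw_imageI)
  note s = direct_subspace[OF assms(2)]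
  have d: "direct Y X" using assms(2) by (simp add: direct_commute)
  show "inj_on (\<lambda>(f, g). \<lambda>x\<in>A. f x + g x) (Hom A X \<times> Hom A Y)"
  proof (rule inj_onI, clarify)
    fix f g f' g' assume *: "f \<in> Hom A X" "g \<in> Hom A Y" "f' \<in> Hom A X" "g' \<in> Hom A Y"
      "(\<lambda>x\<in>A. f x + g x) = (\<lambda>x\<in>A. f' x + g' x)"
    have "f x = f' x \<and> g x = g' x" if x: "x \<in> A" for x
      using direct_unique[OF assms(2) HomD(3)[OF *(1) x] HomD(3)[OF *(3) x] HomD(3)[OF *(2) x] HomD(3)[OF *(4) x]]
        fun_cong[OF *(5), of x] x by simp
    then show "f = f' \<and> g = g'"
      using Hom_eqI[OF *(1,3)] Hom_eqI[OF *(2,4)] by simp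
  qed
  show "(\<lambda>(f, g). \<lambda>x\<in>A. f x + g x) ` (Hom A X \<times> Hom A Y) = Hom A (X + Y)"
  proof (intro subset_antisym subsetI)
    fix h assume h: "h \<in> Hom A (X + Y)"
    let ?f = "\<lambda>x\<in>A. proj X Y (h x)" and ?g = "\<lambda>x\<in>A. proj Y X (h x)"
    have "?f \<in> Hom A X"
      by (intro restrict_in_HomI[OF assms(1)] linear_on_comp[OF HomD(1,2)[OF h]] linear_on_proj
          proj_mem[OF assms(2)] HomD(3)[OF h] assms)
    moreover have "?g \<in> Hom A Y"
      by (intro restrict_in_HomI[OF assms(1)] linear_on_comp[OF HomD(1,2)[OF h]]
          linear_on_proj[OF d, unfolded add.commute[of Y X]]
          proj_mem[OF d, unfolded add.commute[of Y X]] HomD(3)[OF h])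
    moreover have "h = (\<lambda>x\<in>A. ?f x + ?g x)"
      using proj_add_proj[OF assms(2) HomD(3)[OF h]] Hom_extensional[OF h]
      by (intro extensionalityI[of _ A]) auto
    ultimately show "h \<in> (\<lambda>(f, g). \<lambda>x\<in>A. f x + g x) ` (Hom A X \<times> Hom A Y)"
      by (intro image_eqI[of _ _ "(?f, ?g)"]) auto
  next
    fix h assume "h \<in> (\<lambda>(f, g). \<lambda>x\<in>A. f x + g x) ` (Hom A X \<times> Hom A Y)"
    then obtain f g where fg: "f \<in> Hom A X" "g \<in> Hom A Y" "h = (\<lambda>x\<in>A. f x + g x)"
      by auto
    show "h \<in> Hom A (X + Y)"
      unfolding fg(3)
      by (intro restrict_in_HomI[OF assms(1)] linear_on_plus[OF HomD(1)[OF fg(1)] HomD(1)[OF fg(2)]]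
          set_plus_intro HomD(3)[OF fg(1)] HomD(3)[OF fg(2)])
  qed
qed

lemma card_Hom_codomain:
  assumes "subspace A" "direct X Y"
  shows "card {h \<in> Hom A (X + Y). P h} =
    (\<Sum>f\<in>Hom A X. card {g \<in> Hom A Y. P (\<lambda>x\<in>A. f x + g x)})"
  using card_prod_bij[OF bij_betw_Hom_codomain[OF assms]] by simp

section \<open>Reachability and its lifts\<close>

text \<open>
  Only the values of \<open>f\<close> modulo \<open>W\<close> matter, so an operator \<open>S \<rightarrow> S / W\<close> is represented below by any
  lift, usually by the one with values in a fixed complement of \<open>W\<close>.
\<close>

definition generates :: "('b \<Rightarrow> 'b) \<Rightarrow> 'b set \<Rightarrow> 'b set \<Rightarrow> bool" where
  "generates f W S \<longleftrightarrow> (\<forall>R. subspace R \<and> W \<subseteq> R \<and> R \<subseteq> S \<and> f ` R \<subseteq> R \<longrightarrow> R = S)"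

lemma generatesD: "generates f W S \<Longrightarrow> subspace R \<Longrightarrow> W \<subseteq> R \<Longrightarrow> R \<subseteq> S \<Longrightarrow> (\<And>x. x \<in> R \<Longrightarrow> f x \<in> R) \<Longrightarrow> R = S"
  unfolding generates_def by blast

lemma generates_mono: "generates f W S \<Longrightarrow> W \<subseteq> W' \<Longrightarrow> generates f W' S"
  unfolding generates_def by blast

lemma generates_cong_mod:
  assumes "subspace W" "\<And>x. x \<in> S \<Longrightarrow> f x - g x \<in> W"
  shows "generates f W S \<longleftrightarrow> generates g W S"
proof -
  have "f ` R \<subseteq> R \<longleftrightarrow> g ` R \<subseteq> R" if R: "subspace R" "W \<subseteq> R" "R \<subseteq> S" for R
  proof -
    have "f x \<in> R \<longleftrightarrow> g x \<in> R" if "x \<in> R" for x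
    proof -
      have d: "f x - g x \<in> R" using that assms(2) R by blast
      show ?thesis
        using subspace_add[OF R(1) d, of "g x"] subspace_diff[OF R(1) _ d, of "f x"] by auto
    qed
    then show ?thesis by blast
  qed
  then show ?thesis unfolding generates_def by blast
qed

text \<open>An invariant \<open>R\<close> inside \<open>S\<close> that contains \<open>L\<close> and
  the image of \<open>W\<close> gives the invariant space \<open>W + R\<close>, which must be
  everything; as the sums with \<open>W\<close> are direct, dimensions force \<open>R = S\<close>.
  The summand \<open>L\<close> is carried along because in \<open>card_not_generates\<close> a lift
  is at first known to generate only together with \<open>L\<close>.\<close>

lemma generates_reduce:
  assumes "direct W S" "linear_on (W + S) f" "f ` (W + S) \<subseteq> S" "subspace L" "L \<subseteq> S"
    and "generates f (W + L) (W + S)"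
  shows "generates f (f ` W + L) S"
  unfolding generates_def
proof (intro allI impI, elim conjE)
  fix R assume R: "subspace R" "f ` W + L \<subseteq> R" "R \<subseteq> S" "f ` R \<subseteq> R"
  note s = direct_subspace[OF assms(1)]
  have fW: "subspace (f ` W)"
    by (rule subspace_lin_image[OF assms(2) s(1)]) (rule plus_superset1[OF s(2)])
  have fL: "f ` W \<subseteq> R" "L \<subseteq> R"
    using R(2) plus_superset1[OF assms(4), of "f ` W"] plus_superset2[OF fW, of L] by auto
  have dR: "direct W R" by (rule direct_mono[OF assms(1) s(1) R(1)]) (use R in auto)
  have sub: "W + R \<subseteq> W + S" using R(3) by (intro set_plus_mono2) auto
  have "W + R = W + S"
  proof (rule generatesD[OF assms(6)])
    show "subspace (W + R)" using dR by (rule direct_subspace)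
    show "W + L \<subseteq> W + R" using fL by (intro set_plus_mono2) auto
    show "W + R \<subseteq> W + S" by (rule sub)
    fix x assume "x \<in> W + R"
    then obtain w r where wr: "x = w + r" "w \<in> W" "r \<in> R" by (rule set_plus_elim) 
    have "f x = f w + f r"
      unfolding wr(1)
      using plus_superset1[OF s(2), of W] plus_superset2[OF s(1), of S] wr R(3)
      by (intro linear_on_add[OF assms(2)]) auto
    also have "\<dots> \<in> R" using wr fL R by (intro subspace_add[OF R(1)]) auto
    finally show "f x \<in> W + R" using plus_superset2[OF s(1), of R] by auto
  qed
  then have "dim W + dim R = dim W + dim S"
    using dim_plus[OF dR] dim_plus[OF assms(1)] by simp
  then show "R = S" using R s by (intro subspace_dim_equal) auto
qed

text \<open>Since \<open>f\<close> has values in \<open>S\<close>, an invariant \<open>R\<close>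
  above \<open>W\<close> meets \<open>S\<close> in an invariant space that contains the image of
  \<open>W\<close>.\<close>

lemma generates_of_reduce:
  assumes "direct W S" "linear_on (W + S) f" "f ` (W + S) \<subseteq> S" "generates f (f ` W) S"
  shows "generates f W (W + S)"
  unfolding generates_def
proof (intro allI impI, elim conjE)
  fix R assume R: "subspace R" "W \<subseteq> R" "R \<subseteq> W + S" "f ` R \<subseteq> R"
  note s = direct_subspace[OF assms(1)]
  have "R \<inter> S = S"
  proof (rule generatesD[OF assms(4)])
    show "subspace (R \<inter> S)" using R(1) s(2) by (rule subspace_inter)
    have "f ` W \<subseteq> S"
      using assms(3) plus_superset1[OF s(2), of W] by blast
    then show "f ` W \<subseteq> R \<inter> S" using R by blast
    fix x assume x: "x \<in> R \<inter> S"
    then show "f x \<in> R \<inter> S"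
      using R(4) assms(3) R(3) by blast
  qed auto
  then have "W + S \<subseteq> R" using R by (intro plus_least) auto
  then show "R = W + S" using R(3) by simp
qed

lemma generates_reduce_iff:
  assumes "direct W S" "linear_on (W + S) f" "f ` (W + S) \<subseteq> S"
  shows "generates f W (W + S) \<longleftrightarrow> generates f (f ` W) S"
  using generates_reduce[OF assms, of "{0}"] generates_of_reduce[OF assms] direct_subspace[OF assms(1)]
  by (auto simp: subspace_0)

section \<open>Counting the lifts of a reachable operator\<close>

lemma line_eq:
  assumes "subspace L" "dim L = 1" "x \<in> L" "x \<noteq> 0"
  shows "span {x} = L"
  using assms by (intro subspace_dim_equal span_minimal) (auto simp: dim_line[simplified])

lemma bij_betw_Hom_translate:
  assumes "subspace A" "subspace X" "t \<in> Hom A X"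
  shows "bij_betw (\<lambda>h. \<lambda>x\<in>A. t x + h x) (Hom A X) (Hom A X)"
proof (rule bij_betw_byWitness[where f' = "\<lambda>h. \<lambda>x\<in>A. h x - t x"])
  show "\<forall>h\<in>Hom A X. (\<lambda>x\<in>A. (\<lambda>x\<in>A. t x + h x) x - t x) = h"
    using Hom_extensional by (fastforce simp: extensional_def)
  show "\<forall>h\<in>Hom A X. (\<lambda>x\<in>A. t x + (\<lambda>x\<in>A. h x - t x) x) = h"
    using Hom_extensional by (fastforce simp: extensional_def)
  show "(\<lambda>h. \<lambda>x\<in>A. t x + h x) ` Hom A X \<subseteq> Hom A X"
    using HomD(1,3)[OF assms(3)] assms(1,2)
    by (auto intro!: restrict_in_HomI linear_on_plus subspace_add dest: HomD(1,3))
  show "(\<lambda>h. \<lambda>x\<in>A. h x - t x) ` Hom A X \<subseteq> Hom A X"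
    using HomD(1,3)[OF assms(3)] assms(1,2)
    by (auto intro!: restrict_in_HomI linear_on_minus subspace_diff dest: HomD(1,3))
qed

lemma card_Hom_translate:
  assumes "subspace A" "subspace X" "t \<in> Hom A X"
  shows "card {h \<in> Hom A X. P (\<lambda>x\<in>A. t x + h x)} = card {h \<in> Hom A X. P h}"
proof -
  have "bij_betw (\<lambda>h. \<lambda>x\<in>A. t x + h x) {h \<in> Hom A X. P (\<lambda>x\<in>A. t x + h x)} {h \<in> Hom A X. P h}"
    using bij_betw_Hom_translate[OF assms] by (auto simp: bij_betw_def inj_on_def image_iff)
  then show ?thesis by (rule bij_betw_same_card)
qed

lemma zero_in_Hom: "subspace A \<Longrightarrow> subspace X \<Longrightarrow> (\<lambda>x\<in>A. 0) \<in> Hom A X"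
  by (rule restrict_in_HomI) (auto simp: linear_on_def subspace_0)

text \<open>Brings an arbitrary \<open>Y\<close> into the shape required by the induction
  hypothesis, with values in \<open>C\<close>: the component of \<open>Y\<close> in \<open>J\<close>
  is invisible modulo \<open>J\<close>, and the component in \<open>L\<close> only translates
  \<open>h\<close>, which does not change the count.\<close>

lemma card_not_generates_step:
  assumes d: "direct J L" "direct (J + L) C" and J: "J \<subseteq> S" "L \<subseteq> S" "J + L + C = S"
    and Y: "linear_on S Y" "Y ` S \<subseteq> S"
    and IH: "\<And>Z. linear_on S Z \<Longrightarrow> Z ` S \<subseteq> C \<Longrightarrow> generates Z (J + L) S \<Longrightarrow>
      card {h \<in> Hom S L. \<not> generates (\<lambda>x. Z x + h x) J S} = N"
    and generates: "generates Y (J + L) S"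
  shows "card {h \<in> Hom S L. \<not> generates (\<lambda>x. Y x + h x) J S} = N"
proof -
  note s = direct_subspace[OF d(1)] direct_subspace[OF d(2)]
  have sS: "subspace S" using s(6) J(3) by simp
  have d': "direct C (J + L)" "direct L J" using d by (simp_all add: direct_commute)
  note comm = add.commute[of C "J + L"] add.commute[of L J]
  let ?m = "\<lambda>x. proj (J + L) C (Y x)"
  define Z where "Z = (\<lambda>x. proj C (J + L) (Y x))"
  define t where "t = (\<lambda>x\<in>S. proj L J (?m x))"
  have linm: "linear_on S ?m" "?m ` S \<subseteq> J + L"
    using linear_on_comp[OF Y, of "proj (J + L) C"] linear_on_proj[OF d(2)] proj_mem[OF d(2)] Y(2)
    by (auto simp: J(3))
  have t: "t \<in> Hom S L"
    unfolding t_def using proj_mem[OF d'(2)] linm linear_on_proj[OF d'(2)]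
    by (intro restrict_in_HomI[OF sS] linear_on_comp[OF linm]) (auto simp: comm)
  have Z: "linear_on S Z" "Z ` S \<subseteq> C"
    unfolding Z_def
    using linear_on_comp[OF Y, of "proj C (J + L)"] linear_on_proj[OF d'(1)] proj_mem[OF d'(1)] Y(2)
    by (auto simp: J(3) comm)
  have split: "Y x = proj J L (?m x) + t x + Z x" if "x \<in> S" for x
  proof -
    have "Y x \<in> J + L + C" "?m x \<in> J + L" using that Y(2) linm(2) J(3) by blast+
    then show ?thesis
      using proj_add_proj[OF d(2), of "Y x"] proj_add_proj[OF d(1), of "?m x"] that by (simp add: t_def Z_def)
  qed
  have mod: "generates (\<lambda>x. Y x + h x) J S \<longleftrightarrow> generates (\<lambda>x. Z x + (\<lambda>x\<in>S. t x + h x) x) J S" for h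
  proof (rule generates_cong_mod[OF s(1)])
    fix x assume x: "x \<in> S"
    have "Y x + h x - (Z x + (\<lambda>x\<in>S. t x + h x) x) = proj J L (?m x)"
      using split[OF x, symmetric] x by (simp add: diff_eq_eq ac_simps)
    also have "\<dots> \<in> J" using proj_mem[OF d(1)] linm(2) x by blast
    finally show "Y x + h x - (Z x + (\<lambda>x\<in>S. t x + h x) x) \<in> J" .
  qed
  have "generates Z (J + L) S"
  proof (rule generates_cong_mod[OF s(3), THEN iffD1, OF _ generates])
    fix x assume x: "x \<in> S"
    have "Y x - Z x = ?m x"
      using proj_add_proj[OF d(2), of "Y x"] x Y(2) J(3) by (auto simp: Z_def algebra_simps)
    then show "Y x - Z x \<in> J + L" using linm(2) x by auto
  qed
  then show ?thesis
    using IH[OF Z] card_Hom_translate[OF sS s(2) t, of "\<lambda>h. \<not> generates (\<lambda>x. Z x + h x) J S"]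
    by (simp add: mod)
qed

text \<open>
  Induction on the dimension, passing from \<open>W + L + C\<close> to \<open>L + C\<close> with the image of \<open>W\<close> as new starting
  space. If \<open>h\<close> does not vanish on the kernel of \<open>Y\<close> in \<open>W\<close>, that image contains \<open>L\<close>, and the lift
  generates. Otherwise the image is a complement of \<open>L\<close> in its sum with \<open>L\<close>, and the restriction of the
  lift to \<open>L + C\<close> is an instance of the same problem.
\<close>

lemma card_not_generates:
  assumes "direct W L" "direct (W + L) C" "dim L = 1"
    and "linear_on (W + L + C) Y" "Y ` (W + L + C) \<subseteq> C" "generates Y (W + L) (W + L + C)"
  shows "card {h \<in> Hom (W + L + C) L. \<not> generates (\<lambda>x. Y x + h x) W (W + L + C)} = q ^ (dim C + 1)"
  using assms
proof (induction "dim W + dim C" arbitrary: W C Y rule: less_induct)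
  case less
  note d = less.prems(1,2) and dL = less.prems(3) and Y = less.prems(4,5) and genY = less.prems(6)
  note s = direct_subspace[OF d(1)] direct_subspace[OF d(2)]
  define S' where "S' = L + C"
  have d': "direct L C" "direct W S'"
    using direct_assoc[OF d] by (auto simp: S'_def)
  note s' = direct_subspace[OF d'(2)]
  have S_eq: "W + L + C = W + S'" by (simp add: S'_def add.assoc)
  have sub: "L \<subseteq> S'" "C \<subseteq> S'" "W \<subseteq> W + S'" "S' \<subseteq> W + S'"
    using plus_superset1[of C L] plus_superset2[of L C] plus_superset1[of S' W] plus_superset2[of W S'] s s'
    by (auto simp: S'_def)
  note Y = Y[unfolded S_eq] and genY = genY[unfolded S_eq]
  have f: "linear_on (W + S') (\<lambda>x. Y x + h x)" "(\<lambda>x. Y x + h x) ` (W + S') \<subseteq> S'"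
    "generates (\<lambda>x. Y x + h x) (W + L) (W + S')"
    if h: "h \<in> Hom (W + S') L" for h
  proof -
    show "linear_on (W + S') (\<lambda>x. Y x + h x)"
      using Y(1) HomD(1)[OF h] by (rule linear_on_plus)
    show "(\<lambda>x. Y x + h x) ` (W + S') \<subseteq> S'"
      using Y(2) HomD(2)[OF h] sub by (auto intro!: subspace_add[OF s'(2)])
    show "generates (\<lambda>x. Y x + h x) (W + L) (W + S')"
    proof (rule generates_cong_mod[THEN iffD1, OF s(3) _ genY])
      fix x assume "x \<in> W + S'"
      then have "- h x \<in> L" using HomD(3)[OF h] s by (simp add: subspace_neg)
      then show "Y x - (Y x + h x) \<in> W + L" using plus_superset2[OF s(1), of L] by auto
    qed
  qed
  show ?case
  proof (cases "W = {0}")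
    \<comment> \<open>The zero space is invariant, so every \<open>h\<close> fails; there are
      \<open>q ^ dim S'\<close> of them, and \<open>dim S' = dim C + 1\<close>.\<close>
    case True
    have "\<not> generates (\<lambda>x. Y x + h x) W (W + S')" if h: "h \<in> Hom (W + S') L" for h
    proof
      assume g: "generates (\<lambda>x. Y x + h x) W (W + S')"
      have "{0} = W + S'"
        by (rule generatesD[OF g]) (use True linear_on_0[OF f(1)[OF h] s'(3)] s' in \<open>auto simp: subspace_0\<close>)
      then have "L \<subseteq> {0}" using sub by auto
      then have "L = {0}" using subspace_0[OF s(2)] by auto
      then show False using dL by simp
    qed
    then have "{h \<in> Hom (W + S') L. \<not> generates (\<lambda>x. Y x + h x) W (W + S')} = Hom (W + S') L"
      by auto
    then show ?thesis
      using dim_plus[OF d'(1)] dL s'(2) s(2) True by (simp add: S_eq card_Hom S'_def)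
  next
    case False
    \<comment> \<open>Where \<open>Y\<close> vanishes the lift is \<open>h\<close> itself, so the
      kernel separates the two cases; on the complement \<open>U\<close> of the kernel
      \<open>Y\<close> is injective.\<close>
    define K where "K = {x \<in> W. Y x = 0}"
    have "subspace K"
      unfolding K_def by (rule subspace_lin_kernel[OF linear_on_subset[OF Y(1) sub(3)] s(1)])
    then obtain U where U: "direct K U" "K + U = W"
      using exists_complement[of K W] s(1) by (auto simp: K_def)
    note sU = direct_subspace[OF U(1)]
    have dU: "direct U S'" "direct K (U + S')"
      using direct_assoc[OF U(1), of S'] d'(2) U(2) by auto
    note sUS = direct_subspace[OF dU(1)]
    have S_eq': "W + S' = K + (U + S')" using U(2) by (simp add: add.assoc[symmetric])
    have subU: "K \<subseteq> W" "U \<subseteq> W" "U \<subseteq> U + S'" "S' \<subseteq> U + S'"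
      using U(2) plus_superset1[OF sU(2), of K] plus_superset2[OF sU(1), of U]
        plus_superset1[OF sUS(2), of U] plus_superset2[OF sUS(1), of S'] by auto
    have genK: "generates (\<lambda>x. Y x + h x) W (W + S')"
      if h: "h \<in> Hom (W + S') L" and u: "u \<in> K" "h u \<noteq> 0" for h u
    proof -
      let ?f = "\<lambda>x. Y x + h x"
      have "?f u = h u" "u \<in> W" using u by (auto simp: K_def)
      moreover have "h u \<in> L" using HomD(3)[OF h] sub \<open>u \<in> W\<close> by blast
      ultimately have "span {h u} = L" "h u \<in> ?f ` W"
        using line_eq[OF s(2) dL _ u(2)] by (auto intro: image_eqI[of _ _ u])
      moreover have sf: "subspace (?f ` W)"
        by (rule subspace_lin_image[OF f(1)[OF h] s(1) sub(3)])
      ultimately have "L \<subseteq> ?f ` W"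
        using span_minimal[of "{h u}" "?f ` W"] by auto
      then have "?f ` W + L = ?f ` W" by (rule plus_absorb[OF sf s(2)])
      then have "generates ?f (?f ` W) S'"
        using generates_reduce[OF d'(2) f(1,2)[OF h] s(2) sub(1) f(3)[OF h]] by simp
      then show ?thesis using generates_reduce_iff[OF d'(2) f(1,2)[OF h]] by simp
    qed
    let ?z = "\<lambda>x\<in>K. 0 :: 'b"
    let ?P = "\<lambda>h. \<not> generates (\<lambda>x. Y x + h x) W (W + S')"
    \<comment> \<open>The bound on \<open>dim U\<close> is proved along with the count, so that the
      difference in the exponent is a true one when the powers are multiplied at the end.\<close>
    have each: "card {hS \<in> Hom S' L. ?P (glue K (U + S') ?z (glue U S' hU hS))} = q ^ (dim C - dim U + 1)
      \<and> dim U \<le> dim C"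
      if hU: "hU \<in> Hom U L" for hU
    proof -
      let ?J = "(\<lambda>x. Y x + hU x) ` U"
      have lU: "linear_on U (\<lambda>x. Y x + hU x)"
        using linear_on_plus[OF linear_on_subset[OF Y(1)] HomD(1)[OF hU]] subU sub by blast
      \<comment> \<open>\<open>Y\<close> has values in \<open>C\<close> and \<open>hU\<close> in
        \<open>L\<close>, and these meet trivially. The fact gives both the dimension of
        \<open>?J\<close> and its independence from \<open>L\<close>.\<close>
      have inj: "x = 0" if "x \<in> U" "Y x + hU x \<in> L" for x
      proof -
        have "Y x = Y x + hU x - hU x" by simp
        also have "\<dots> \<in> L" using that HomD(3)[OF hU] by (intro subspace_diff[OF s(2)]) auto
        finally have "Y x \<in> L \<inter> C" using that(1) Y(2) subU sub by blast
        then have "x \<in> K \<inter> U" using d'(1) that subU by (auto simp: direct_def K_def)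
        then show ?thesis using U(1) by (auto simp: direct_def)
      qed
      have J: "subspace ?J" "dim ?J = dim U"
        using dim_lin_image_inj[OF lU sU(2)] inj s(2) subspace_lin_image[OF lU sU(2)]
        by (auto simp: subspace_0)
      have JL: "direct ?J L"
        using inj linear_on_0[OF lU sU(2)] by (intro directI[OF J(1) s(2)]) fastforce
      have JS: "?J \<subseteq> S'"
      proof
        fix y assume "y \<in> ?J"
        then obtain x where "x \<in> U" "y = Y x + hU x" by blast
        moreover have "Y x \<in> S'" using \<open>x \<in> U\<close> Y(2) subU sub by blast
        moreover have "hU x \<in> S'" using \<open>x \<in> U\<close> HomD(3)[OF hU] sub by blast
        ultimately show "y \<in> S'" by (simp add: subspace_add[OF s'(2)])
      qed
      obtain C1 where C1: "direct (?J + L) C1" "?J + L + C1 = S'"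
        using exists_complement[OF direct_subspace(3)[OF JL] s'(2) plus_least[OF s'(2) JS sub(1)]] by blast
      have dimC1: "dim C = dim U + dim C1"
        using dim_plus[OF C1(1)] dim_plus[OF JL] dim_plus[OF d'(1)] J(2) dL C1(2)
        by (simp add: S'_def)
      let ?F = "\<lambda>hS. glue K (U + S') ?z (glue U S' hU hS)"
      have F: "?F hS \<in> Hom (W + S') L" "\<And>x. x \<in> S' \<Longrightarrow> ?F hS x = hS x"
        "(\<lambda>x. Y x + ?F hS x) ` W = ?J"
        if hS: "hS \<in> Hom S' L" for hS
      proof -
        have g: "glue U S' hU hS \<in> Hom (U + S') L"
          by (rule glue_in_Hom[OF dU(1) s(2) hU hS])
        have z: "?z \<in> Hom K L" by (rule zero_in_Hom[OF sU(1) s(2)])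
        show h: "?F hS \<in> Hom (W + S') L"
          unfolding S_eq' by (rule glue_in_Hom[OF dU(2) s(2) z g])
        have hK: "?F hS x = 0" if "x \<in> K" for x
          using glue_left[OF dU(2) g that] that by simp
        have hU': "?F hS x = hU x" if "x \<in> U" for x
          using glue_right[OF dU(2) z, of x] glue_left[OF dU(1) hS that] that subU by auto
        show "?F hS x = hS x" if "x \<in> S'" for x
          using glue_right[OF dU(2) z, of x] glue_right[OF dU(1) hU that] that subU by auto
        let ?f = "\<lambda>x. Y x + ?F hS x"
        have "?f ` W = ?f ` K + ?f ` U"
          unfolding U(2)[symmetric]
          by (rule lin_image_plus[OF _ sU(1,2)])
            (use linear_on_subset[OF f(1)[OF h] sub(3)] U(2) in auto)
        moreover have "?f ` K = {0}"
          using hK subspace_0[OF sU(1)] by (force simp: K_def)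
        moreover have "?f ` U = ?J" using hU' by (intro image_cong) auto
        ultimately show "?f ` W = ?J" by simp
      qed
      have eq: "?P (?F hS) \<longleftrightarrow> \<not> generates (\<lambda>x. Y x + hS x) ?J S'" if hS: "hS \<in> Hom S' L" for hS
      proof -
        have "generates (\<lambda>x. Y x + ?F hS x) W (W + S') \<longleftrightarrow> generates (\<lambda>x. Y x + ?F hS x) ?J S'"
          using generates_reduce_iff[OF d'(2) f(1,2)[OF F(1)[OF hS]]] F(3)[OF hS] by simp
        also have "\<dots> \<longleftrightarrow> generates (\<lambda>x. Y x + hS x) ?J S'"
          using F(2)[OF hS] subspace_0[OF J(1)] by (intro generates_cong_mod[OF J(1)]) auto
        finally show ?thesis by simp
      qed
      \<comment> \<open>Reachability for the smaller problem is read off from the lift with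
        \<open>hS = 0\<close>, which agrees with \<open>Y\<close> on \<open>S'\<close>.\<close>
      have genJ: "generates Y (?J + L) S'"
      proof -
        have hS: "(\<lambda>x\<in>S'. 0) \<in> Hom S' L" by (rule zero_in_Hom[OF s'(2) s(2)])
        have g: "generates (\<lambda>x. Y x + ?F (\<lambda>x\<in>S'. 0) x) (?J + L) S'"
          using generates_reduce[OF d'(2) f(1,2)[OF F(1)[OF hS]] s(2) sub(1) f(3)[OF F(1)[OF hS]]] F(3)[OF hS]
          by simp
        show ?thesis
          by (rule generates_cong_mod[THEN iffD1, OF _ _ g])
            (use F(2)[OF hS] direct_subspace(3)[OF JL] in \<open>auto simp: subspace_0\<close>)
      qed
      have "card {hS \<in> Hom S' L. \<not> generates (\<lambda>x. Y x + hS x) ?J S'} = q ^ (dim C1 + 1)"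
      proof (rule card_not_generates_step[OF JL C1(1) JS sub(1) C1(2)])
        show "linear_on S' Y" by (rule linear_on_subset[OF Y(1) sub(4)])
        show "Y ` S' \<subseteq> S'" using Y(2) sub by blast
        show "generates Y (?J + L) S'" by (rule genJ)
        fix Z assume Z: "linear_on S' Z" "Z ` S' \<subseteq> C1" "generates Z (?J + L) S'"
        \<comment> \<open>The measure of the smaller problem is \<open>dim C\<close>, because
          \<open>C1\<close> is smaller than \<open>C\<close> by \<open>dim U = dim ?J\<close>; it
          drops since \<open>W\<close> is nonzero.\<close>
        have "0 < dim W" using False dim_eq_0_iff[OF s(1)] by simp
        then have "dim ?J + dim C1 < dim W + dim C" using dimC1 J(2) by simp
        from less.hyps[OF this JL C1(1) dL] Z
        show "card {h \<in> Hom S' L. \<not> generates (\<lambda>x. Z x + h x) ?J S'} = q ^ (dim C1 + 1)"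
          by (simp add: C1(2))
      qed
      then show ?thesis using eq dimC1 by (simp cong: conj_cong)
    qed
    have zero: "card {h' \<in> Hom (U + S') L. ?P (glue K (U + S') hK h')} = 0"
      if hK: "hK \<in> Hom K L" "hK \<noteq> ?z" for hK
    proof -
      obtain u where u: "u \<in> K" "hK u \<noteq> 0"
        using Hom_eqI[OF hK(1) zero_in_Hom[OF sU(1) s(2)]] hK(2) by auto
      have "generates (\<lambda>x. Y x + glue K (U + S') hK h' x) W (W + S')" if h': "h' \<in> Hom (U + S') L" for h'
        using genK[OF glue_in_Hom[OF dU(2) s(2) hK(1) h', folded S_eq'] u(1)]
          glue_left[OF dU(2) h' u(1), of hK] u(2) by simp
      then show ?thesis by simp
    qed
    have "card {h \<in> Hom (W + S') L. ?P h} =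
        (\<Sum>hK\<in>Hom K L. card {h' \<in> Hom (U + S') L. ?P (glue K (U + S') hK h')})"
      unfolding S_eq'
      by (rule card_Hom_domain[OF dU(2) s(2)])
    also have "\<dots> = card {h' \<in> Hom (U + S') L. ?P (glue K (U + S') ?z h')}"
      using zero by (subst sum.remove[of _ ?z]) (auto simp: zero_in_Hom[OF sU(1) s(2)])
    also have "\<dots> = (\<Sum>hU\<in>Hom U L. card {hS \<in> Hom S' L. ?P (glue K (U + S') ?z (glue U S' hU hS))})"
      by (rule card_Hom_domain[OF dU(1) s(2)])
    also have "\<dots> = q ^ dim U * q ^ (dim C - dim U + 1)"
      using each by (simp add: card_Hom sU(2) s(2) dL)
    also have "\<dots> = q ^ (dim C + 1)"
      using each[OF zero_in_Hom[OF sU(2) s(2)]] by (simp add: power_add[symmetric])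
    finally show ?thesis by (simp add: S_eq)
  qed
qed

lemma exists_line:
  assumes "subspace W" "W \<noteq> {0}"
  obtains w W' where "w \<noteq> 0" "direct W' (span {w})" "W' + span {w} = W" "Suc (dim W') = dim W"
proof -
  obtain w where w: "w \<in> W" "w \<noteq> 0" using assms subspace_0 by blast
  then have "span {w} \<subseteq> W" using assms by (simp add: span_minimal)
  then obtain W' where "direct (span {w}) W'" "span {w} + W' = W"
    using exists_complement[OF _ assms(1), of "span {w}"] by auto
  then show ?thesis
    using that[of w W'] w dim_plus[of "span {w}" W'] dim_line[of w]
    by (simp add: direct_commute add.commute)
qed

text \<open>A line \<open>L\<close> is split off, \<open>W = W' + L\<close>, and \<open>h\<close>
  into \<open>h2\<close> with values in \<open>L\<close> and \<open>h1\<close> with values in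
  \<open>W'\<close>. First \<open>h2\<close> must keep \<open>B + W'\<close> reachable, which leaves
  \<open>q ^ dim S - q ^ (dim C + 1)\<close> choices; then \<open>L\<close> joins the complement and
  the next factor has its index raised by one.\<close>

lemma card_lifts_generates:
  assumes "direct B W" "direct (B + W) C" "linear_on (B + W + C) Y" "Y ` (B + W + C) \<subseteq> C"
    and "generates Y (B + W) (B + W + C)"
  shows "card {h \<in> Hom (B + W + C) W. generates (\<lambda>x. Y x + h x) B (B + W + C)} =
    (\<Prod>i\<in>{dim C<..dim C + dim W}. q ^ dim (B + W + C) - q ^ i)"
  using assms
proof (induction "dim W" arbitrary: W C Y)
  case 0
  define S where "S = B + W + C"
  have W: "W = {0}"
    using 0 dim_eq_0_iff[of W] direct_subspace[OF \<open>direct B W\<close>] by simp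
  have sS: "subspace S" unfolding S_def using direct_subspace[OF 0(3)] by blast
  have "{h \<in> Hom S W. generates (\<lambda>x. Y x + h x) B S} = Hom S W"
  proof (intro subset_antisym subsetI)
    fix h assume h: "h \<in> Hom S W"
    have "generates (\<lambda>x. Y x + h x) B S \<longleftrightarrow> generates Y B S"
      using HomD(3)[OF h] W 0(2) by (intro generates_cong_mod) (auto simp: direct_def subspace_0)
    then show "h \<in> {h \<in> Hom S W. generates (\<lambda>x. Y x + h x) B S}"
      using h 0 W by (simp add: S_def)
  qed auto
  then show ?case
    using 0(1) card_Hom[OF sS, of W] W by (simp add: S_def)
next
  case (Suc d)
  note d = Suc.prems(1,2) and Y = Suc.prems(3,4) and genY = Suc.prems(5)
  define S where "S = B + W + C"
  have sW: "subspace W" "subspace S" using direct_subspace[OF d(1)] direct_subspace[OF d(2)] by (auto simp: S_def)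
  have "W \<noteq> {0}" using Suc.hyps(2) by auto
  then obtain w W' where w: "w \<noteq> 0" "direct W' (span {w})" "W' + span {w} = W" "Suc (dim W') = dim W"
    by (rule exists_line[OF sW(1)])
  define L where "L = span {w}"
  have L: "direct W' L" "W' + L = W" "dim L = 1" "direct L W'" "L + W' = W"
    using w dim_line[OF w(1)] by (simp_all add: L_def direct_commute add.commute)
  have d1: "direct B W'" "direct (B + W') L"
    using direct_assoc_left[OF L(1), of B] d(1) L(2) by auto
  have d2: "direct (B + W' + L) C" "B + W' + L + C = S"
    using d(2) L(2) by (auto simp: S_def add.assoc)
  have d3: "direct L C" "direct (B + W') (L + C)" "B + W' + (L + C) = S"
    using direct_assoc[OF d1(2) d2(1)] d2(2) by (auto simp: add.assoc)
  note sd = direct_subspace[OF d1(1)] direct_subspace[OF d1(2)] direct_subspace[OF d3(1)]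
  have dim3: "dim (L + C) = Suc (dim C)" using dim_plus[OF d3(1)] L(3) by simp
  have YS: "linear_on S Y" "Y ` S \<subseteq> C" "generates Y (B + W) S" using Y genY by (simp_all add: S_def)
  let ?G = "{h2 \<in> Hom S L. generates (\<lambda>x. Y x + h2 x) (B + W') S}"
  have genYL: "generates Y (B + W' + L) S" using YS(3) L(2) by (simp add: add.assoc)
  have "card {h2 \<in> Hom S L. \<not> generates (\<lambda>x. Y x + h2 x) (B + W') S} = q ^ (dim C + 1)"
    using card_not_generates[OF d1(2) d2(1) L(3), of Y] YS genYL d2(2) by simp
  moreover have "card {h2 \<in> Hom S L. \<not> generates (\<lambda>x. Y x + h2 x) (B + W') S} = card (Hom S L) - card ?G"
    by (subst card_Diff_subset[symmetric]) (auto intro: arg_cong[where f = card])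
  moreover have "card ?G \<le> card (Hom S L)" by (intro card_mono) auto
  ultimately have cardG: "card ?G = q ^ dim S - q ^ Suc (dim C)"
    using card_Hom[OF sW(2) sd(5)] L(3) by simp
  have inner: "card {h1 \<in> Hom S W'. generates (\<lambda>x. Y x + (\<lambda>x\<in>S. h2 x + h1 x) x) B S} =
      (if h2 \<in> ?G then \<Prod>i\<in>{Suc (dim C)<..dim C + dim W}. q ^ dim S - q ^ i else 0)"
    if h2: "h2 \<in> Hom S L" for h2
  proof -
    have eq: "generates (\<lambda>x. Y x + (\<lambda>x\<in>S. h2 x + h1 x) x) B S \<longleftrightarrow> generates (\<lambda>x. (Y x + h2 x) + h1 x) B S" for h1
      by (rule generates_cong_mod) (use sd in \<open>auto simp: subspace_0 add.assoc\<close>)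
    have lY: "linear_on S (\<lambda>x. Y x + h2 x)" "(\<lambda>x. Y x + h2 x) ` S \<subseteq> L + C"
      using linear_on_plus[OF YS(1) HomD(1)[OF h2]] YS(2) HomD(2)[OF h2]
      by (auto simp: add.commute[of _ "h2 _"] intro!: set_plus_intro)
    show ?thesis
    proof (cases "h2 \<in> ?G")
      case True
      have "card {h1 \<in> Hom S W'. generates (\<lambda>x. (Y x + h2 x) + h1 x) B S} =
          (\<Prod>i\<in>{dim (L + C)<..dim (L + C) + dim W'}. q ^ dim S - q ^ i)"
        using Suc.hyps(1)[of W' "L + C" "\<lambda>x. Y x + h2 x"] Suc.hyps(2) w(4) d1(1) d3 lY True by simp
      then show ?thesis using True unfolding eq dim3 by (simp add: w(4)[symmetric])
    next
      case False
      \<comment> \<open>Reachability from \<open>B\<close> implies reachability from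
        \<open>B + W'\<close>, where \<open>h1\<close> is invisible; so \<open>h1\<close> cannot
        repair a failing \<open>h2\<close>.\<close>
      have "\<not> generates (\<lambda>x. (Y x + h2 x) + h1 x) B S" if h1: "h1 \<in> Hom S W'" for h1
      proof
        assume "generates (\<lambda>x. (Y x + h2 x) + h1 x) B S"
        then have "generates (\<lambda>x. (Y x + h2 x) + h1 x) (B + W') S"
          by (rule generates_mono) (rule plus_superset1[OF sd(2)])
        then have "generates (\<lambda>x. Y x + h2 x) (B + W') S"
          by (rule generates_cong_mod[THEN iffD1, OF sd(3), rotated])
            (use HomD(3)[OF h1] plus_superset2[OF sd(1), of W'] in auto)
        then show False using False h2 by simp
      qed
      then have "{h1 \<in> Hom S W'. generates (\<lambda>x. (Y x + h2 x) + h1 x) B S} = {}" by blast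
      then show ?thesis unfolding eq if_not_P[OF False] by simp
    qed
  qed
  have "card {h \<in> Hom S (L + W'). generates (\<lambda>x. Y x + h x) B S} =
      (\<Sum>h2\<in>Hom S L. card {h1 \<in> Hom S W'. generates (\<lambda>x. Y x + (\<lambda>x\<in>S. h2 x + h1 x) x) B S})"
    by (rule card_Hom_codomain[OF sW(2) L(4)])
  also have "\<dots> = (\<Sum>h2\<in>Hom S L. if h2 \<in> ?G then \<Prod>i\<in>{Suc (dim C)<..dim C + dim W}. q ^ dim S - q ^ i else 0)"
    by (intro sum.cong refl inner)
  also have "\<dots> = card ?G * (\<Prod>i\<in>{Suc (dim C)<..dim C + dim W}. q ^ dim S - q ^ i)"
    by (subst sum.inter_filter[symmetric]) simp_all
  also have "\<dots> = (\<Prod>i\<in>{dim C<..dim C + dim W}. q ^ dim S - q ^ i)"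
  proof -
    have "{dim C<..dim C + dim W} = insert (Suc (dim C)) {Suc (dim C)<..dim C + dim W}"
      using Suc.hyps(2) by auto
    then show ?thesis by (simp add: cardG)
  qed
  finally show ?case using L(5) by (simp add: S_def)
qed

text \<open>A line is split off the domain. The value on its generator either lies in the image so
  far and keeps the rank, or lies outside and raises it by one; the two cases are the two terms of
  the Pascal rule for \<open>qbin\<close>.\<close>

lemma card_Hom_rank:
  assumes "subspace W" "subspace C"
  shows "card {f \<in> Hom W C. dim (f ` W) = i} = qbin q (dim W) i * qfall q (dim C) i"
  using assms(1)
proof (induction "dim W" arbitrary: W i)
  case 0
  then have W: "W = {0}" using dim_eq_0_iff by metis
  have im: "f ` W = {0}" if "f \<in> Hom W C" for f
    using linear_on_0[OF HomD(1)[OF that] 0(2)] W by simp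
  have "{f \<in> Hom W C. dim (f ` W) = i} = (if i = 0 then Hom W C else {})"
    using im by auto
  then show ?case
    using card_Hom[OF 0(2) assms(2)] 0(1) by (cases i) auto
next
  case (Suc d)
  then have "W \<noteq> {0}" by auto
  then obtain w W' where w: "w \<noteq> 0" "direct W' (span {w})" "W' + span {w} = W" "Suc (dim W') = dim W"
    by (rule exists_line[OF Suc.prems])
  note s = direct_subspace[OF w(2)]
  let ?m = "dim C"
  \<comment> \<open>Here \<open>i\<close> is the rank of the whole map. For \<open>i = 0\<close> the
    second condition is false, so the truncated \<open>i - 1\<close> does no harm.\<close>
  have each: "card {f2 \<in> Hom (span {w}) C. dim (glue W' (span {w}) f1 f2 ` W) = i} =
      (if dim (f1 ` W') = i then q ^ i else 0) +
      (if Suc (dim (f1 ` W')) = i then q ^ ?m - q ^ (i - 1) else 0)"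
    if f1: "f1 \<in> Hom W' C" for f1
  proof -
    let ?I = "f1 ` W'"
    have I: "subspace ?I" "?I \<subseteq> C"
      using subspace_lin_image[OF HomD(1)[OF f1] s(1)] HomD(2)[OF f1] by auto
    have dimI: "dim (?I + span {c}) = (if c \<in> ?I then dim ?I else Suc (dim ?I))" for c
    proof (cases "c \<in> ?I")
      case True
      then show ?thesis
        using plus_absorb[OF I(1) subspace_span, of "{c}"] I(1) by (simp add: span_minimal)
    next
      case False
      then have c0: "c \<noteq> 0" using subspace_0[OF I(1)] by auto
      have "direct ?I (span {c})"
      proof (rule directI[OF I(1) subspace_span], rule subsetI)
        fix x assume x: "x \<in> ?I \<inter> span {c}"
        then have "x \<in> span {c}" by blast
        show "x \<in> {0}"
        proof (rule ccontr)
          assume "x \<notin> {0}"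
          then have "span {x} = span {c}"
            using line_eq[OF subspace_span dim_line[OF c0] \<open>x \<in> span {c}\<close>] by simp
          then have "c \<in> span {x}" by (simp add: span_base)
          moreover have "span {x} \<subseteq> ?I" using x I(1) by (simp add: span_minimal)
          ultimately show False using False by blast
        qed
      qed
      then show ?thesis using False dim_plus[of ?I "span {c}"] dim_line[OF c0] by simp
    qed
    have im: "glue W' (span {w}) f1 f2 ` W = ?I + span {f2 w}" if f2: "f2 \<in> Hom (span {w}) C" for f2
    proof -
      let ?g = "glue W' (span {w}) f1 f2"
      have "?g ` W = ?g ` W' + ?g ` span {w}"
        unfolding w(3)[symmetric]
        by (rule lin_image_plus[OF HomD(1)[OF glue_in_Hom[OF w(2) assms(2) f1 f2]] s(1,2)])
      also have "?g ` W' = ?I"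
        using glue_left[OF w(2) f2] by (intro image_cong) auto
      also have "?g ` span {w} = f2 ` span {w}"
        using glue_right[OF w(2) f1] by (intro image_cong) auto
      also have "\<dots> = span {f2 w}"
      proof -
        have "f2 (scale k w) = scale k (f2 w)" for k
          by (rule linear_on_scale[OF HomD(1)[OF f2]]) (simp add: span_base)
        then show ?thesis by (simp add: span_singleton image_image)
      qed
      finally show ?thesis .
    qed
    have "card {f2 \<in> Hom (span {w}) C. dim (glue W' (span {w}) f1 f2 ` W) = i} =
        card {f2 \<in> Hom (span {w}) C. dim (?I + span {f2 w}) = i}"
      using im by (intro arg_cong[where f = card]) auto
    also have "\<dots> = card {c \<in> C. dim (?I + span {c}) = i}"
    proof (rule bij_betw_same_card)
      show "bij_betw (\<lambda>f. f w) {f2 \<in> Hom (span {w}) C. dim (?I + span {f2 w}) = i} {c \<in> C. dim (?I + span {c}) = i}"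
        using bij_betw_Hom_line[OF w(1) assms(2)] by (auto simp: bij_betw_def inj_on_def image_iff)
    qed
    also have "{c \<in> C. dim (?I + span {c}) = i} =
        (if dim ?I = i then ?I else {}) \<union> (if Suc (dim ?I) = i then C - ?I else {})"
      using I(2) by (auto simp: dimI split: if_splits)
    also have "card \<dots> = (if dim ?I = i then q ^ i else 0) + (if Suc (dim ?I) = i then q ^ ?m - q ^ (i - 1) else 0)"
      using card_eq_power_dim[OF I(1)] card_subspace_remainder[OF I(1) _ I(2)] card_eq_power_dim[OF assms(2)] by auto
    finally show ?thesis .
  qed
  have "card {f \<in> Hom W C. dim (f ` W) = i} =
      (\<Sum>f1\<in>Hom W' C. card {f2 \<in> Hom (span {w}) C. dim (glue W' (span {w}) f1 f2 ` W) = i})"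
    using card_Hom_domain[OF w(2) assms(2), of "\<lambda>f. dim (f ` W) = i"] w(3) by simp
  also have "\<dots> = (\<Sum>f1\<in>Hom W' C. (if dim (f1 ` W') = i then q ^ i else 0) +
      (if Suc (dim (f1 ` W')) = i then q ^ ?m - q ^ (i - 1) else 0))"
    by (intro sum.cong refl each)
  also have "\<dots> = card {f1 \<in> Hom W' C. dim (f1 ` W') = i} * q ^ i +
      card {f1 \<in> Hom W' C. Suc (dim (f1 ` W')) = i} * (q ^ ?m - q ^ (i - 1))"
    by (simp add: sum.distrib sum.inter_filter[symmetric])
  also have "\<dots> = qbin q (dim W) i * qfall q ?m i"
  proof (cases i)
    case 0
    then show ?thesis using Suc.hyps(1)[of W' 0] Suc.hyps(2) w(4) s(1) by simp
  next
    case (Suc j)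
    then show ?thesis
      using Suc.hyps(1)[of W' i] Suc.hyps(1)[of W' j] \<open>Suc d = dim W\<close> w(4)[symmetric] s(1)
      by (simp add: qfall_Suc add_mult_distrib add_mult_distrib2 mult_ac)
  qed
  finally show ?case .
qed

section \<open>Profiles\<close>

text \<open>The Horner form of W + f W + ... + f^(j-1) W. Each application of \<open>f\<close> is
  followed by adding \<open>W\<close>, so a change of \<open>f\<close> by vectors of
  \<open>W\<close> is absorbed at every stage, which is what makes profiles depend on
  \<open>f\<close> modulo \<open>W\<close> only.\<close>

fun krylov_sum :: "('b \<Rightarrow> 'b) \<Rightarrow> nat \<Rightarrow> 'b set \<Rightarrow> 'b set" where
  "krylov_sum f 0 W = {0}"
| "krylov_sum f (Suc j) W = W + f ` krylov_sum f j W"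

text \<open>
  Parts are indexed from \<open>0\<close> here: \<open>\<nu> i\<close> stands for \<open>\<mu> (i + 1)\<close>.
\<close>

definition profile :: "('b \<Rightarrow> 'b) \<Rightarrow> 'b set \<Rightarrow> (nat \<Rightarrow> nat) \<Rightarrow> bool" where
  "profile f W \<nu> \<longleftrightarrow> (\<forall>j. dim (krylov_sum f j W) = (\<Sum>i<j. \<nu> i))"

lemma krylov_sum_subspace:
  assumes "subspace S" "linear_on S f" "f ` S \<subseteq> S" "subspace W" "W \<subseteq> S"
  shows "subspace (krylov_sum f j W)" "krylov_sum f j W \<subseteq> S"
proof -
  have "subspace (krylov_sum f j W) \<and> krylov_sum f j W \<subseteq> S"
  proof (induction j)
    case (Suc j)
    then have "subspace (f ` krylov_sum f j W)" using subspace_lin_image[OF assms(2)] by blast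
    moreover have "f ` krylov_sum f j W \<subseteq> S" using Suc assms(3) by blast
    ultimately show ?case
      using subspace_plus[OF assms(4)] plus_least[OF assms(1,5)] by simp
  qed (use assms(1) in \<open>simp add: subspace_0\<close>)
  then show "subspace (krylov_sum f j W)" "krylov_sum f j W \<subseteq> S" by auto
qed

lemma plus_image_cong_mod:
  assumes "subspace W" "\<And>x. x \<in> K \<Longrightarrow> f x - g x \<in> W"
  shows "W + f ` K = W + g ` K"
proof (intro subset_antisym subsetI)
  fix y assume "y \<in> W + f ` K"
  then obtain w x where "y = w + f x" "w \<in> W" "x \<in> K" by (auto elim!: set_plus_elim)
  then have "y = (w + (f x - g x)) + g x" "w + (f x - g x) \<in> W" "x \<in> K"
    using assms by (auto intro: subspace_add)
  then show "y \<in> W + g ` K" by blast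
next
  fix y assume "y \<in> W + g ` K"
  then obtain w x where "y = w + g x" "w \<in> W" "x \<in> K" by (auto elim!: set_plus_elim)
  then have "y = (w - (f x - g x)) + f x" "w - (f x - g x) \<in> W" "x \<in> K"
    using assms by (auto intro: subspace_diff)
  then show "y \<in> W + f ` K" by blast
qed

lemma krylov_sum_cong_mod:
  assumes "subspace S" "linear_on S f" "f ` S \<subseteq> S" "subspace W" "W \<subseteq> S"
    and "\<And>x. x \<in> S \<Longrightarrow> f x - g x \<in> W"
  shows "krylov_sum f j W = krylov_sum g j W"
proof (induction j)
  case (Suc j)
  have "krylov_sum f j W \<subseteq> S" by (rule krylov_sum_subspace[OF assms(1-5)])
  then have "W + f ` krylov_sum f j W = W + g ` krylov_sum f j W"
    using assms(6) by (intro plus_image_cong_mod[OF assms(4)]) auto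
  then show ?case using Suc by simp
qed simp

lemma profile_cong_mod:
  assumes "subspace S" "linear_on S f" "f ` S \<subseteq> S" "subspace W" "W \<subseteq> S"
    and "\<And>x. x \<in> S \<Longrightarrow> f x - g x \<in> W"
  shows "profile f W \<nu> = profile g W \<nu>"
  using krylov_sum_cong_mod[OF assms] by (simp add: profile_def)

lemma profile_dim: "profile f W \<nu> \<Longrightarrow> subspace W \<Longrightarrow> f 0 = 0 \<Longrightarrow> dim W = \<nu> 0"
  unfolding profile_def by (drule spec[of _ 1]) simp

lemma krylov_sum_le:
  assumes "subspace R" "W \<subseteq> R" "f ` R \<subseteq> R"
  shows "krylov_sum f j W \<subseteq> R"
proof (induction j)
  case (Suc j)
  then show ?case using assms plus_least[OF assms(1), of W "f ` krylov_sum f j W"] by auto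
qed (use assms in \<open>simp add: subspace_0\<close>)

text \<open>The parts add up to \<open>dim S\<close>, so the \<open>N\<close>-th sum fills
  \<open>S\<close>, and every invariant subspace above \<open>W\<close> contains that sum.\<close>

lemma profile_generates:
  assumes "subspace S" "linear_on S f" "f ` S \<subseteq> S" "subspace W" "W \<subseteq> S"
    and "profile f W \<nu>" "(\<Sum>i<N. \<nu> i) = dim S"
  shows "generates f W S"
  unfolding generates_def
proof (intro allI impI, elim conjE)
  fix R assume R: "subspace R" "W \<subseteq> R" "R \<subseteq> S" "f ` R \<subseteq> R"
  have "krylov_sum f N W = S"
    using krylov_sum_subspace[OF assms(1-5), of N] assms(1,6,7)
    by (intro subspace_dim_equal) (auto simp: profile_def)
  then show "R = S" using krylov_sum_le[OF R(1,2,4), of N] R(3) by auto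
qed

text \<open>As \<open>f\<close> maps everything into \<open>C\<close>, splitting off
  \<open>W\<close> leaves the same construction inside \<open>C\<close>, started from the image of
  \<open>W\<close>.\<close>

lemma krylov_sum_reduce:
  assumes "direct W C" "linear_on (W + C) f" "f ` (W + C) \<subseteq> C"
  shows "krylov_sum f (Suc j) W = W + krylov_sum f j (f ` W)"
proof (induction j)
  case 0
  have "f 0 = 0" using linear_on_0[OF assms(2)] direct_subspace[OF assms(1)] by simp
  then show ?case by simp
next
  case (Suc j)
  note s = direct_subspace[OF assms(1)]
  have sub: "W \<subseteq> W + C" "C \<subseteq> W + C"
    using plus_superset1[OF s(2)] plus_superset2[OF s(1)] by auto
  have I: "subspace (f ` W)" "f ` W \<subseteq> C"
    using subspace_lin_image[OF assms(2) s(1) sub(1)] assms(3) sub by auto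
  have fC: "linear_on C f" "f ` C \<subseteq> C"
    using linear_on_subset[OF assms(2) sub(2)] assms(3) sub by auto
  note K = krylov_sum_subspace[OF s(2) fC I, of j]
  have "W + krylov_sum f j (f ` W) \<subseteq> W + C" using K(2) by (intro set_plus_mono2) auto
  then have "f ` (W + krylov_sum f j (f ` W)) = f ` W + f ` krylov_sum f j (f ` W)"
    using linear_on_subset[OF assms(2)] by (intro lin_image_plus s(1) K(1)) auto
  then show ?case using Suc by simp
qed

text \<open>The sum in \<open>krylov_sum_reduce\<close> is direct, so every dimension drops by
  \<open>dim W\<close>. This is the removal of the first part.\<close>

lemma profile_reduce:
  assumes "direct W C" "linear_on (W + C) f" "f ` (W + C) \<subseteq> C" "dim W = \<nu> 0"
  shows "profile f W \<nu> \<longleftrightarrow> profile f (f ` W) (\<lambda>i. \<nu> (Suc i))"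
proof -
  note s = direct_subspace[OF assms(1)]
  have sub: "W \<subseteq> W + C" "C \<subseteq> W + C"
    using plus_superset1[OF s(2)] plus_superset2[OF s(1)] by auto
  have I: "subspace (f ` W)" "f ` W \<subseteq> C"
    using subspace_lin_image[OF assms(2) s(1) sub(1)] assms(3) sub by auto
  have fC: "linear_on C f" "f ` C \<subseteq> C"
    using linear_on_subset[OF assms(2) sub(2)] assms(3) sub by auto
  have dim: "dim (krylov_sum f (Suc j) W) = \<nu> 0 + dim (krylov_sum f j (f ` W))" for j
    unfolding krylov_sum_reduce[OF assms(1-3)] assms(4)[symmetric]
    using krylov_sum_subspace[OF s(2) fC I, of j] s
    by (intro dim_plus direct_mono[OF assms(1)]) auto
  show ?thesis
  proof
    assume "profile f W \<nu>"
    then have "dim (krylov_sum f (Suc j) W) = (\<Sum>i<Suc j. \<nu> i)" for j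
      unfolding profile_def by blast
    then show "profile f (f ` W) (\<lambda>i. \<nu> (Suc i))"
      unfolding profile_def dim sum.lessThan_Suc_shift by simp
  next
    assume *: "profile f (f ` W) (\<lambda>i. \<nu> (Suc i))"
    have "dim (krylov_sum f j W) = (\<Sum>i<j. \<nu> i)" for j
    proof (cases j)
      case (Suc k)
      show ?thesis unfolding Suc dim sum.lessThan_Suc_shift using * by (simp add: profile_def)
    qed simp
    then show "profile f W \<nu>" by (simp add: profile_def)
  qed
qed

text \<open>\<open>Y\<close> is split into \<open>f\<close> on \<open>W\<close> and \<open>A\<close>
  on \<open>C\<close>. The profile forces \<open>f\<close> to have rank \<open>\<nu> 1\<close>. With
  \<open>I\<close> the image of \<open>f\<close>, the component of \<open>A\<close> in
  \<open>I\<close> is free and gives \<open>q ^ (dim C * \<nu> 1)\<close>; the component in a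
  complement of \<open>I\<close> is an instance of the same problem with one part fewer.\<close>

lemma card_Hom_profile:
  assumes "direct W C" "dim W = \<nu> 0" "\<And>i. N \<le> i \<Longrightarrow> \<nu> i = 0" "dim W + dim C = (\<Sum>i<N. \<nu> i)"
  shows "card {Y \<in> Hom (W + C) C. profile Y W \<nu>} = q ^ dim C * qfall q (dim C) (dim C) * profile_factor q N \<nu>"
  using assms
proof (induction N arbitrary: W C \<nu>)
  case 0
  note s = direct_subspace[OF 0(1)]
  have WC: "W = {0}" "C = {0}"
    using 0(4) dim_eq_0_iff[OF s(1)] dim_eq_0_iff[OF s(2)] by auto
  have f: "profile f W \<nu>" if f: "f \<in> Hom {0} {0}" for f
  proof -
    have "krylov_sum f j W = {0}" for j
      using krylov_sum_subspace(2)[OF _ HomD(1,2)[OF f], of W j] krylov_sum_subspace(1)[OF _ HomD(1,2)[OF f], of W j] WC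
        subspace_0 by auto
    then show ?thesis using 0(3) by (simp add: profile_def)
  qed
  then have "{Y \<in> Hom (W + C) C. profile Y W \<nu>} = Hom {0} {0}" using WC by auto
  then show ?case using card_Hom[of "{0}" "{0}"] WC by (simp add: profile_factor_def)
next
  case (Suc N)
  note s = direct_subspace[OF Suc.prems(1)]
  let ?\<nu> = "\<lambda>i. \<nu> (Suc i)"
  let ?m = "dim C" and ?i = "\<nu> 1"
  have dimC: "?m = (\<Sum>i<N. ?\<nu> i)"
    using Suc.prems(2,4) unfolding sum.lessThan_Suc_shift by simp
  \<comment> \<open>Makes \<open>d\<close> a true difference; for \<open>N = 0\<close> the part
    \<open>\<nu> 1\<close> already lies beyond the last nonzero part.\<close>
  have im: "?i \<le> ?m"
  proof (cases "N = 0")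
    case True
    then show ?thesis using Suc.prems(3)[of 1] by simp
  next
    case False
    then show ?thesis unfolding dimC using member_le_sum[of 0 "{..<N}" ?\<nu>] by simp
  qed
  define d where "d = ?m - ?i"
  have md: "?m = ?i + d" using im by (simp add: d_def)
  have sub: "W \<subseteq> W + C" "C \<subseteq> W + C"
    using plus_superset1[OF s(2)] plus_superset2[OF s(1)] by auto
  have glue: "profile (glue W C f A) W \<nu> \<longleftrightarrow> profile A (f ` W) ?\<nu>"
    if f: "f \<in> Hom W C" and A: "A \<in> Hom C C" for f A
  proof -
    note g = glue_in_Hom[OF Suc.prems(1) s(2) f A]
    have "glue W C f A ` W = f ` W"
      using glue_left[OF Suc.prems(1) A] by (intro image_cong) auto
    then have "profile (glue W C f A) W \<nu> \<longleftrightarrow> profile (glue W C f A) (f ` W) ?\<nu>"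
      using profile_reduce[where \<nu> = \<nu>, OF Suc.prems(1) HomD(1,2)[OF g] Suc.prems(2)] by simp
    also have "\<dots> \<longleftrightarrow> profile A (f ` W) ?\<nu>"
    proof (rule profile_cong_mod[OF s(2)])
      show "linear_on C (glue W C f A)" using linear_on_subset[OF HomD(1)[OF g] sub(2)] .
      show "glue W C f A ` C \<subseteq> C" using HomD(2)[OF g] sub by blast
      show I: "subspace (f ` W)" using subspace_lin_image[OF HomD(1)[OF f] s(1)] by simp
      show "f ` W \<subseteq> C" using HomD(2)[OF f] .
      show "glue W C f A x - A x \<in> f ` W" if "x \<in> C" for x
        using glue_right[OF Suc.prems(1) f that] subspace_0[OF I] by simp
    qed
    finally show ?thesis .
  qed
  have inner: "card {A \<in> Hom C C. profile A (f ` W) ?\<nu>} =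
      (if dim (f ` W) = ?i then q ^ (?m * ?i) * (q ^ d * qfall q d d * profile_factor q N ?\<nu>) else 0)"
    if f: "f \<in> Hom W C" for f
  proof -
    let ?I = "f ` W"
    have I: "subspace ?I" "?I \<subseteq> C"
      using subspace_lin_image[OF HomD(1)[OF f] s(1)] HomD(2)[OF f] by auto
    show ?thesis
    proof (cases "dim ?I = ?i")
      case False
      have "\<not> profile A ?I ?\<nu>" if A: "A \<in> Hom C C" for A
        using profile_dim[of A ?I ?\<nu>] I(1) linear_on_0[OF HomD(1)[OF A] s(2)] False by auto
      then have "{A \<in> Hom C C. profile A ?I ?\<nu>} = {}" by blast
      then show ?thesis unfolding if_not_P[OF False] by simp
    next
      case True
      obtain C1 where C1: "direct ?I C1" "?I + C1 = C"
        using exists_complement[OF I(1) s(2) I(2)] by blast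
      note sC1 = direct_subspace[OF C1(1)]
      have dC1: "dim C1 = d" using dim_plus[OF C1(1)] C1(2) True md by simp
      have eq: "profile (\<lambda>x\<in>C. A1 x + A0 x) ?I ?\<nu> \<longleftrightarrow> profile A0 ?I ?\<nu>"
        if "A1 \<in> Hom C ?I" "A0 \<in> Hom C C1" for A1 A0
      proof (rule profile_cong_mod[OF s(2) _ _ I])
        have h: "(\<lambda>x\<in>C. A1 x + A0 x) \<in> Hom C C"
          using bij_betwE[OF bij_betw_Hom_codomain[OF s(2) C1(1)]] that C1(2) by auto
        show "linear_on C (\<lambda>x\<in>C. A1 x + A0 x)" "(\<lambda>x\<in>C. A1 x + A0 x) ` C \<subseteq> C"
          using HomD(1,2)[OF h] .
        show "(\<lambda>x\<in>C. A1 x + A0 x) x - A0 x \<in> ?I" if "x \<in> C" for x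
          using that HomD(3)[OF \<open>A1 \<in> Hom C ?I\<close>] by simp
      qed
      have "card {A \<in> Hom C (?I + C1). profile A ?I ?\<nu>} =
          (\<Sum>A1\<in>Hom C ?I. card {A0 \<in> Hom C C1. profile (\<lambda>x\<in>C. A1 x + A0 x) ?I ?\<nu>})"
        by (rule card_Hom_codomain[OF s(2) C1(1)])
      also have "\<dots> = (\<Sum>A1\<in>Hom C ?I. card {A0 \<in> Hom C C1. profile A0 ?I ?\<nu>})"
        by (intro sum.cong refl arg_cong[where f = card]) (use eq in auto)
      also have "card {A0 \<in> Hom C C1. profile A0 ?I ?\<nu>} = q ^ d * qfall q d d * profile_factor q N ?\<nu>"
        using Suc.IH[OF C1(1), of ?\<nu>] True Suc.prems(3) dimC dim_plus[OF C1(1)] C1(2) dC1 by simp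
      finally show ?thesis using True C1(2) card_Hom[OF s(2) I(1)] by simp
    qed
  qed
  have "card {Y \<in> Hom (W + C) C. profile Y W \<nu>} =
      (\<Sum>f\<in>Hom W C. card {A \<in> Hom C C. profile (glue W C f A) W \<nu>})"
    by (rule card_Hom_domain[OF Suc.prems(1) s(2)])
  also have "\<dots> = (\<Sum>f\<in>Hom W C. card {A \<in> Hom C C. profile A (f ` W) ?\<nu>})"
    by (intro sum.cong refl arg_cong[where f = card]) (use glue in auto)
  also have "\<dots> = (\<Sum>f\<in>Hom W C. if dim (f ` W) = ?i
      then q ^ (?m * ?i) * (q ^ d * qfall q d d * profile_factor q N ?\<nu>) else 0)"
    by (intro sum.cong refl inner)
  also have "\<dots> = card {f \<in> Hom W C. dim (f ` W) = ?i} * (q ^ (?m * ?i) * (q ^ d * qfall q d d * profile_factor q N ?\<nu>))"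
    by (subst sum.inter_filter[symmetric]) simp_all
  also have "\<dots> = (qfall q ?m ?i * q ^ (?m * ?i) * (q ^ d * qfall q d d)) * (qbin q (\<nu> 0) ?i * profile_factor q N ?\<nu>)"
    by (simp add: card_Hom_rank[OF s(1,2)] Suc.prems(2))
  also have "\<dots> = q ^ ?m * qfall q ?m ?m * profile_factor q (Suc N) \<nu>"
    unfolding md qfall_exponents profile_factor_Suc by simp
  finally show ?case .
qed

section \<open>Subspaces through a cyclic vector\<close>

lemma linear_on_UNIV: "linear_on UNIV f \<longleftrightarrow> Vector_Spaces.linear scale scale f"
  by (simp add: linear_on_def Vector_Spaces.linear_iff vector_space_axioms)

section \<open>Cyclic vectors and conjugacy modulo \<open>v\<close>\<close>

lemma span_image_lessThan:
  "x \<in> span (k ` {..<n::nat}) \<Longrightarrow> \<exists>a. x = (\<Sum>i<n. scale (a i) (k i))"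
proof (induction n arbitrary: x)
  case (Suc n)
  then obtain c where "x - scale c (k n) \<in> span (k ` {..<n})"
    by (auto simp: lessThan_Suc span_insert)
  then obtain a where a: "x - scale c (k n) = (\<Sum>i<n. scale (a i) (k i))"
    using Suc.IH by blast
  have "x = (\<Sum>i<Suc n. scale ((a(n := c)) i) (k i))"
    using a by (simp add: algebra_simps)
  then show ?case by blast
qed simp

text \<open>The spans of the first \<open>j\<close> iterates gain a dimension at each step until two
  consecutive ones agree; then the span is invariant and contains \<open>v\<close>, hence is the
  whole space.\<close>

lemma krylov_spans:
  assumes "Vector_Spaces.linear scale scale f" "generates f (span {v}) UNIV"
  shows "span ((\<lambda>i. (f ^^ i) v) ` {..<dim UNIV}) = UNIV"
proof -
  let ?k = "\<lambda>i. (f ^^ i) v" and ?R = "\<lambda>j. span ((\<lambda>i. (f ^^ i) v) ` {..<j})"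
  have "j \<le> dim (?R j) \<or> ?R j = UNIV" for j
  proof (induction j)
    case (Suc j)
    have sub: "?R j \<subseteq> ?R (Suc j)" by (intro span_mono) auto
    show ?case
    proof (cases "?R (Suc j) = ?R j")
      case True
      have "f ` ?R j = span (f ` ?k ` {..<j})"
        using assms(1) by (simp add: pair.linear_span_image)
      also have "\<dots> \<subseteq> ?R (Suc j)"
      proof (rule span_mono, rule subsetI)
        fix y assume "y \<in> f ` ?k ` {..<j}"
        then obtain i where "i < j" "y = ?k (Suc i)" by auto
        then show "y \<in> ?k ` {..<Suc j}" by blast
      qed
      finally have inv: "f ` ?R j \<subseteq> ?R j" using True by simp
      have "?k 0 \<in> ?R (Suc j)" by (intro span_base imageI) simp
      then have "span {v} \<subseteq> ?R j" using True by (intro span_minimal) auto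
      then have "?R j = UNIV"
        using inv by (intro generatesD[OF assms(2)]) auto
      then show ?thesis using True by simp
    next
      case False
      then have "dim (?R j) \<noteq> dim (?R (Suc j))"
        using subspace_dim_equal[OF _ _ sub] by auto
      then have "dim (?R j) < dim (?R (Suc j))"
        using dim_mono_subspace[OF _ _ sub] by simp
      moreover have "?R j \<noteq> UNIV" using False sub by auto
      ultimately show ?thesis using Suc by simp
    qed
  qed simp
  from this[of "dim UNIV"] show ?thesis
    using subspace_dim_equal[of "?R (dim UNIV)" UNIV] dim_mono_subspace[of "?R (dim UNIV)" UNIV]
    by auto
qed

text \<open>
  The vectors \<open>e i\<close> are the Horner partial sums of the relation expressing \<open>f\<^sup>n v\<close> through the lower
  powers, hence \<open>e n = 0\<close>.
\<close>

lemma feedback_normal_form: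
  assumes "Vector_Spaces.linear scale scale f" "generates f (span {v}) UNIV"
  obtains e where "e 0 = v" "e (dim UNIV) = 0" "span (e ` {..<dim UNIV}) = UNIV"
    "\<And>i. i < dim UNIV \<Longrightarrow> f (e i) - e (Suc i) \<in> span {v}"
proof -
  let ?n = "dim UNIV" and ?k = "\<lambda>i. (f ^^ i) v"
  obtain a where a: "?k ?n = (\<Sum>i<?n. scale (a i) (?k i))"
    using span_image_lessThan[of "?k ?n" ?k ?n] krylov_spans[OF assms] by auto
  \<comment> \<open>The offset \<open>?n - i\<close> is chosen so that \<open>f (e i)\<close> and
    \<open>e (Suc i)\<close> differ only by the term \<open>j = 0\<close> of the latter sum, a
    multiple of \<open>v\<close>. At \<open>i = ?n\<close> the sum becomes the relation for the
    \<open>?n\<close>-th iterate.\<close>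
  define e where "e i = ?k i - (\<Sum>j<i. scale (a (?n - i + j)) (?k j))" for i
  have e0: "e 0 = v" by (simp add: e_def)
  have en: "e ?n = 0" using a by (simp add: e_def)
  have step: "f (e i) = e (Suc i) + scale (a (?n - Suc i)) v" if "i < ?n" for i
  proof -
    have "f (e i) = ?k (Suc i) - (\<Sum>j<i. scale (a (?n - i + j)) (?k (Suc j)))"
      unfolding e_def
      by (simp add: pair.linear_diff[OF assms(1)] pair.linear_sum[OF assms(1)] pair.linear_scale[OF assms(1)])
    also have "\<dots> = ?k (Suc i) - (\<Sum>j<i. scale (a (?n - Suc i + Suc j)) (?k (Suc j)))"
      using that by (simp add: Suc_diff_Suc)
    also have "\<dots> = e (Suc i) + scale (a (?n - Suc i)) v"
      unfolding e_def sum.lessThan_Suc_shift by simp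
    finally show ?thesis .
  qed
  \<comment> \<open>The \<open>e i\<close> come from the iterates by a unitriangular change, which
    can be inverted recursively.\<close>
  have "?k i \<in> span (e ` {..<?n})" if "i < ?n" for i
    using that
  proof (induction i rule: less_induct)
    case (less i)
    have "?k i = e i + (\<Sum>j<i. scale (a (?n - i + j)) (?k j))" by (simp add: e_def)
    also have "\<dots> \<in> span (e ` {..<?n})"
      using less by (intro span_add span_sum span_scale less.IH) (auto intro: span_base)
    finally show ?case .
  qed
  then have "span (?k ` {..<?n}) \<subseteq> span (e ` {..<?n})"
    by (intro span_minimal) auto
  then have "span (e ` {..<?n}) = UNIV" using krylov_spans[OF assms] by auto
  then show thesis
    using that[of e] e0 en step by (simp add: span_scale span_base)
qed

lemma basis_of_spanning:
  assumes "span (e ` {..<dim UNIV}) = UNIV"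
  shows "independent (e ` {..<dim UNIV})" "inj_on e {..<dim UNIV}"
proof -
  obtain B where B: "B \<subseteq> e ` {..<dim UNIV}" "independent B" "e ` {..<dim UNIV} \<subseteq> span B"
    using maximal_independent_subset by blast
  have "span B = UNIV"
    using span_minimal[OF B(3)] assms by auto
  then have card: "card B = dim UNIV"
    using dim_span_eq_card_independent[OF B(2)] by simp
  have le: "card (e ` {..<dim UNIV}) \<le> dim UNIV"
    using card_image_le[of "{..<dim UNIV}" e] by simp
  then have "B = e ` {..<dim UNIV}"
    using B(1) card by (intro card_seteq) auto
  then show "independent (e ` {..<dim UNIV})" "inj_on e {..<dim UNIV}"
    using B(2) card by (auto intro: eq_card_imp_inj_on)
qed

text \<open>Modulo \<open>v\<close> each operator shifts its own sequence from the normal form, so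
  the map that carries one basis to the other conjugates them. In control theory this is the
  feedback equivalence of reachable single-input systems.\<close>

lemma exists_feedback_equivalence:
  assumes "Vector_Spaces.linear scale scale f" "Vector_Spaces.linear scale scale g" "v \<noteq> 0"
    and "generates f (span {v}) UNIV" "generates g (span {v}) UNIV"
  obtains \<phi> where "Vector_Spaces.linear scale scale \<phi>" "bij \<phi>" "\<phi> v = v"
    "\<And>x. \<phi> (f x) - g (\<phi> x) \<in> span {v}"
proof -
  let ?n = "dim UNIV"
  obtain e where e: "e 0 = v" "e ?n = 0" "span (e ` {..<?n}) = UNIV"
    "\<And>i. i < ?n \<Longrightarrow> f (e i) - e (Suc i) \<in> span {v}"
    using feedback_normal_form[OF assms(1,4)] by metis
  obtain e' where e': "e' 0 = v" "e' ?n = 0" "span (e' ` {..<?n}) = UNIV"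
    "\<And>i. i < ?n \<Longrightarrow> g (e' i) - e' (Suc i) \<in> span {v}"
    using feedback_normal_form[OF assms(2,5)] by metis
  note b = basis_of_spanning[OF e(3)]
  obtain \<phi> where phi: "Vector_Spaces.linear scale scale \<phi>"
    "\<forall>x\<in>e ` {..<?n}. \<phi> x = (e' \<circ> inv_into {..<?n} e) x"
    using pair.linear_independent_extend[OF b(1)] by blast
  \<comment> \<open>The index \<open>?n\<close>, where both vectors are \<open>0\<close>, is
    included because it is the successor of the last basis index.\<close>
  have ei: "\<phi> (e i) = e' i" if "i \<le> ?n" for i
  proof (cases "i = ?n")
    case True
    then show ?thesis using e(2) e'(2) pair.linear_0[OF phi(1)] by simp
  next
    case False
    then show ?thesis using phi(2) b(2) that by simp
  qed
  have v: "\<phi> v = v" using ei[of 0] e(1) e'(1) by simp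
  have "range \<phi> = span (\<phi> ` e ` {..<?n})"
    using pair.linear_span_image[OF phi(1), of "e ` {..<?n}"] e(3) by simp
  also have "\<phi> ` e ` {..<?n} = e' ` {..<?n}"
    unfolding image_image using ei by (intro image_cong) auto
  finally have "surj \<phi>" using e'(3) by simp
  then have bij: "bij \<phi>" by (simp add: bij_def finite_UNIV_surj_inj)
  have "\<phi> (f x) - g (\<phi> x) \<in> span {v}" for x
  proof -
    let ?\<psi> = "\<lambda>x. \<phi> (f x) - g (\<phi> x)"
    have lin: "Vector_Spaces.linear scale scale ?\<psi>"
      using pair.linear_compose_sub[OF Vector_Spaces.linear_compose[OF assms(1) phi(1)]
          Vector_Spaces.linear_compose[OF phi(1) assms(2)]]
      by (simp add: o_def)
    have "?\<psi> (e i) \<in> span {v}" if "i < ?n" for i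
    proof -
      have "?\<psi> (e i) = \<phi> (f (e i) - e (Suc i)) - (g (e' i) - e' (Suc i))"
        using ei[of i] ei[of "Suc i"] that by (simp add: pair.linear_diff[OF phi(1)])
      moreover have "\<phi> (f (e i) - e (Suc i)) \<in> span {v}"
        using e(4)[OF that] pair.linear_scale[OF phi(1)] v by (auto simp: span_singleton)
      ultimately show ?thesis using e'(4)[OF that] by (simp add: span_diff)
    qed
    then have "span (?\<psi> ` e ` {..<?n}) \<subseteq> span {v}"
      by (intro span_minimal) auto
    then show ?thesis
      using pair.linear_span_image[OF lin, of "e ` {..<?n}"] e(3) by auto
  qed
  then show thesis using that phi(1) bij v by blast
qed

text \<open>The two operators match only up to multiples of \<open>v\<close>; as \<open>W\<close>
  contains \<open>v\<close>, the image of \<open>W\<close> absorbs the discrepancy.\<close>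

lemma krylov_sum_conjugate:
  assumes "Vector_Spaces.linear scale scale \<phi>" "subspace W" "v \<in> W" "\<phi> v = v"
    and "\<And>x. \<phi> (f x) - g (\<phi> x) \<in> span {v}"
  shows "krylov_sum g j (\<phi> ` W) = \<phi> ` krylov_sum f j W"
proof (induction j)
  case 0
  then show ?case using pair.linear_0[OF assms(1)] by simp
next
  case (Suc j)
  have sW: "subspace (\<phi> ` W)" by (rule pair.linear_subspace_image[OF assms(1,2)])
  have "v \<in> \<phi> ` W" using assms(3,4) by (metis imageI)
  then have sub: "span {v} \<subseteq> \<phi> ` W" by (intro span_minimal sW) auto
  have "\<phi> ` (W + X) = \<phi> ` W + \<phi> ` X" for X
  proof (intro subset_antisym subsetI)
    fix y assume "y \<in> \<phi> ` W + \<phi> ` X"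
    then obtain a b where "a \<in> W" "b \<in> X" "y = \<phi> a + \<phi> b" by (auto elim!: set_plus_elim)
    then show "y \<in> \<phi> ` (W + X)"
      using pair.linear_add[OF assms(1), of a b] by (metis imageI set_plus_intro)
  next
    fix y assume "y \<in> \<phi> ` (W + X)"
    then obtain a b where "a \<in> W" "b \<in> X" "y = \<phi> (a + b)" by (auto elim!: set_plus_elim)
    then show "y \<in> \<phi> ` W + \<phi> ` X"
      using pair.linear_add[OF assms(1), of a b] set_plus_intro[of "\<phi> a" "\<phi> ` W" "\<phi> b" "\<phi> ` X"] by simp
  qed
  then have "\<phi> ` (W + f ` krylov_sum f j W) = \<phi> ` W + (\<lambda>x. \<phi> (f x)) ` krylov_sum f j W"
    by (simp add: image_image)
  also have "\<dots> = \<phi> ` W + (\<lambda>x. g (\<phi> x)) ` krylov_sum f j W"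
    using assms(5) sub by (intro plus_image_cong_mod[OF sW]) auto
  finally show ?case using Suc by (simp add: image_image)
qed

text \<open>The conjugating automorphism transports subspaces injectively. The situation is
  symmetric in \<open>f\<close> and \<open>g\<close>, so an inequality is enough.\<close>

lemma card_profile_containing_le:
  assumes "Vector_Spaces.linear scale scale f" "Vector_Spaces.linear scale scale g" "v \<noteq> 0"
    and "generates f (span {v}) UNIV" "generates g (span {v}) UNIV"
  shows "card {W. subspace W \<and> v \<in> W \<and> profile f W \<nu>} \<le> card {W. subspace W \<and> v \<in> W \<and> profile g W \<nu>}"
proof -
  obtain \<phi> where phi: "Vector_Spaces.linear scale scale \<phi>" "bij \<phi>" "\<phi> v = v"
    "\<And>x. \<phi> (f x) - g (\<phi> x) \<in> span {v}"
    using exists_feedback_equivalence[OF assms] by metis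
  have inj: "inj \<phi>" using phi(2) by (rule bij_is_inj)
  have "\<phi> ` W \<in> {W. subspace W \<and> v \<in> W \<and> profile g W \<nu>}"
    if W: "subspace W" "v \<in> W" "profile f W \<nu>" for W
  proof -
    have sk: "subspace (krylov_sum f j W)" for j
      by (rule krylov_sum_subspace(1)[of UNIV]) (use W assms(1) in \<open>auto simp: linear_on_UNIV\<close>)
    have "dim (\<phi> ` U) = dim U" if "subspace U" for U
      using that card_eq_power_dim[of U] card_image[OF inj_on_subset[OF inj subset_UNIV], of U]
        pair.linear_subspace_image[OF phi(1)]
      by (intro dim_eqI) auto
    then show ?thesis
      using W sk krylov_sum_conjugate[where f = f and g = g and v = v, OF phi(1) W(1,2) phi(3,4)] pair.linear_subspace_image[OF phi(1)] phi(3)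
      by (auto simp: profile_def intro: image_eqI[of v \<phi> v])
  qed
  then show ?thesis
    using inj by (intro card_inj_on_le[where f = "\<lambda>W. \<phi> ` W"])
      (auto simp: inj_on_def inj_image_eq_iff)
qed

lemma card_profile_containing_eq:
  assumes "Vector_Spaces.linear scale scale f" "Vector_Spaces.linear scale scale g" "v \<noteq> 0"
    and "generates f (span {v}) UNIV" "generates g (span {v}) UNIV"
  shows "card {W. subspace W \<and> v \<in> W \<and> profile f W \<nu>} = card {W. subspace W \<and> v \<in> W \<and> profile g W \<nu>}"
  using card_profile_containing_le[OF assms] card_profile_containing_le[OF assms(2,1,3,5,4)]
  by (rule antisym)

section \<open>Double counting of operators modulo \<open>v\<close> and subspaces\<close>

lemma plus_Int_complement:
  assumes "L + H = UNIV" "subspace W" "L \<subseteq> W"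
  shows "L + (W \<inter> H) = W"
proof
  show "W \<subseteq> L + (W \<inter> H)"
  proof
    fix x assume x: "x \<in> W"
    obtain l h where lh: "x = l + h" "l \<in> L" "h \<in> H"
      using assms(1) set_plus_elim[of x L H] by auto
    have "x - l \<in> W" using x lh(2) assms(2,3) by (intro subspace_diff) auto
    then have "h \<in> W" using lh(1) by simp
    then show "x \<in> L + (W \<inter> H)" using lh by auto
  qed
  show "L + (W \<inter> H) \<subseteq> W" by (rule plus_least[OF assms(2,3)]) simp
qed

text \<open>The complement \<open>H\<close> plays the quotient by \<open>L\<close>: \<open>W\<close>
  corresponds to its intersection with \<open>H\<close>.\<close>

lemma card_subspaces_containing:
  assumes "direct L H" "L + H = UNIV"
  shows "card {W. subspace W \<and> L \<subseteq> W \<and> dim W = dim L + k} = card {U. subspace U \<and> U \<subseteq> H \<and> dim U = k}"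
proof -
  note s = direct_subspace[OF assms(1)]
  note 1 = plus_Int_complement[OF assms(2)]
  have d: "direct L U" if "subspace U" "U \<subseteq> H" for U
    by (rule direct_mono[OF assms(1) s(1)]) (use that in auto)
  have 2: "(L + U) \<inter> H = U" if U: "subspace U" "U \<subseteq> H" for U
  proof
    show "(L + U) \<inter> H \<subseteq> U"
    proof
      fix x assume x: "x \<in> (L + U) \<inter> H"
      then obtain l u where lu: "x = l + u" "l \<in> L" "u \<in> U" by (auto elim: set_plus_elim)
      have "l + u = 0 + x" "u \<in> H" "x \<in> H" using lu U(2) x by auto
      then have "u = x"
        using direct_unique[OF assms(1) lu(2) subspace_0[OF s(1)], of u x] by blast
      then show "x \<in> U" using lu(3) by simp
    qed
    show "U \<subseteq> (L + U) \<inter> H" using plus_superset2[OF s(1), of U] U by auto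
  qed
  have "bij_betw (\<lambda>U. L + U) {U. subspace U \<and> U \<subseteq> H \<and> dim U = k} {W. subspace W \<and> L \<subseteq> W \<and> dim W = dim L + k}"
  proof (rule bij_betw_byWitness[where f' = "\<lambda>W. W \<inter> H"])
    show "(\<lambda>W. W \<inter> H) ` {W. subspace W \<and> L \<subseteq> W \<and> dim W = dim L + k} \<subseteq> {U. subspace U \<and> U \<subseteq> H \<and> dim U = k}"
    proof clarify
      fix W assume W: "subspace W" "L \<subseteq> W" "dim W = dim L + k"
      have "subspace (W \<inter> H)" using W(1) s(2) by (rule subspace_inter)
      moreover have "dim L + dim (W \<inter> H) = dim W"
        using dim_plus[OF d[OF \<open>subspace (W \<inter> H)\<close>]] unfolding 1[OF W(1,2)] by simp
      ultimately show "subspace (W \<inter> H) \<and> W \<inter> H \<subseteq> H \<and> dim (W \<inter> H) = k"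
        using W(3) by simp
    qed
    show "(\<lambda>U. L + U) ` {U. subspace U \<and> U \<subseteq> H \<and> dim U = k} \<subseteq> {W. subspace W \<and> L \<subseteq> W \<and> dim W = dim L + k}"
    proof clarify
      fix U assume U: "subspace U" "U \<subseteq> H" "k = dim U"
      show "subspace (L + U) \<and> L \<subseteq> L + U \<and> dim (L + U) = dim L + dim U"
        using direct_subspace(3)[OF d[OF U(1,2)]] plus_superset1[OF U(1)] dim_plus[OF d[OF U(1,2)]] by blast
    qed
    show "\<forall>U\<in>{U. subspace U \<and> U \<subseteq> H \<and> dim U = k}. (L + U) \<inter> H = U"
      using 2 by blast
    show "\<forall>W\<in>{W. subspace W \<and> L \<subseteq> W \<and> dim W = dim L + k}. L + (W \<inter> H) = W"
      using 1 by blast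
  qed
  then show ?thesis by (rule bij_betw_same_card[symmetric])
qed

text \<open>The extreme case of the lifting count: it starts from the whole space, where the zero
  operator is reachable, and shrinks down to \<open>L\<close>.\<close>

lemma card_reachable:
  assumes "direct L H" "L + H = UNIV"
  shows "card {Y \<in> Hom UNIV H. generates Y L UNIV} = (\<Prod>i\<in>{0<..dim H}. q ^ dim UNIV - q ^ i)"
proof -
  note s = direct_subspace[OF assms(1)]
  have "direct UNIV {0}" by (rule directI) auto
  moreover have "generates (\<lambda>_. 0) UNIV UNIV" unfolding generates_def by auto
  moreover have "linear_on UNIV (\<lambda>_. 0)" by (simp add: linear_on_def)
  ultimately show ?thesis
    using card_lifts_generates[OF assms(1), of "{0}" "\<lambda>_. 0"] by (simp add: assms(2))
qed

text \<open>With \<open>H = C + W0\<close>, the component of \<open>Y\<close> in \<open>C\<close> is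
  the operator modulo \<open>W\<close> and decides the profile; the component in \<open>W0\<close>
  is the lift and decides reachability from \<open>L\<close>.\<close>

lemma card_reachable_profile:
  assumes "direct L H" "L + H = UNIV" "subspace W" "L \<subseteq> W" "dim W = \<nu> 0"
    and "\<And>i. N \<le> i \<Longrightarrow> \<nu> i = 0" "(\<Sum>i<N. \<nu> i) = dim UNIV" "c = dim UNIV - \<nu> 0"
  shows "card {Y \<in> {Y \<in> Hom UNIV H. generates Y L UNIV}. profile Y W \<nu>} =
    q ^ c * qfall q c c * profile_factor q N \<nu> * (\<Prod>i\<in>{c<..dim H}. q ^ dim UNIV - q ^ i)"
proof -
  note s = direct_subspace[OF assms(1)]
  obtain W0 where W0: "direct L W0" "L + W0 = W" "W0 \<subseteq> H"
  proof (rule that[of "W \<inter> H"])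
    show "direct L (W \<inter> H)"
      by (rule direct_mono[OF assms(1) s(1)]) (use assms(3) s(2) in \<open>auto intro: subspace_inter\<close>)
  qed (simp_all add: plus_Int_complement[OF assms(2-4)])
  note sW0 = direct_subspace[OF W0(1)]
  obtain C where C: "direct W0 C" "W0 + C = H"
    using exists_complement[OF sW0(2) s(2) W0(3)] by blast
  note sC = direct_subspace[OF C(1)]
  have dC: "direct C W0" "C + W0 = H" using C by (simp_all add: direct_commute add.commute)
  have WC: "direct W C" "W + C = UNIV"
    using direct_assoc_left[OF C(1), of L] assms(1,2) W0(2) C(2) by (auto simp: add.assoc)
  have dims: "dim W + dim C = dim UNIV" "dim H = dim W0 + dim C" "dim C = c"
    using dim_plus[OF WC(1)] dim_plus[OF C(1)] WC(2) C(2) assms(5,8) by auto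
  have inner: "card {h \<in> Hom UNIV W0. generates (\<lambda>x. Y x + h x) L UNIV \<and> profile (\<lambda>x. Y x + h x) W \<nu>} =
      (if profile Y W \<nu> then \<Prod>i\<in>{c<..dim H}. q ^ dim UNIV - q ^ i else 0)"
    if Y: "Y \<in> Hom UNIV C" for Y
  proof -
    have eq: "profile (\<lambda>x. Y x + h x) W \<nu> \<longleftrightarrow> profile Y W \<nu>" if h: "h \<in> Hom UNIV W0" for h
      using linear_on_plus[OF HomD(1)[OF Y] HomD(1)[OF h]] HomD(3)[OF h] plus_superset2[OF sW0(1), of W0] W0(2) assms(3)
      by (intro profile_cong_mod[of UNIV]) auto
    show ?thesis
    proof (cases "profile Y W \<nu>")
      case True
      have g: "generates Y W UNIV"
        by (rule profile_generates[of UNIV Y W \<nu> N]) (use True HomD(1)[OF Y] assms(3,7) in auto)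
      have "{h \<in> Hom UNIV W0. generates (\<lambda>x. Y x + h x) L UNIV \<and> profile (\<lambda>x. Y x + h x) W \<nu>} =
          {h \<in> Hom UNIV W0. generates (\<lambda>x. Y x + h x) L UNIV}"
        using eq True by blast
      then show ?thesis
        using True card_lifts_generates[OF W0(1), of C Y] W0(2) WC HomD(1,2)[OF Y] g dims by (simp add: add.commute)
    next
      case False
      then have "{h \<in> Hom UNIV W0. generates (\<lambda>x. Y x + h x) L UNIV \<and> profile (\<lambda>x. Y x + h x) W \<nu>} = {}"
        using eq by blast
      then show ?thesis unfolding if_not_P[OF False] by simp
    qed
  qed
  have "card {Y \<in> {Y \<in> Hom UNIV H. generates Y L UNIV}. profile Y W \<nu>} =
      card {Y \<in> Hom UNIV (C + W0). generates Y L UNIV \<and> profile Y W \<nu>}"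
    using dC(2) by (simp add: conj_assoc)
  also have "\<dots> = (\<Sum>Y\<in>Hom UNIV C. card {h \<in> Hom UNIV W0. generates (\<lambda>x. Y x + h x) L UNIV \<and> profile (\<lambda>x. Y x + h x) W \<nu>})"
    using card_Hom_codomain[OF subspace_UNIV dC(1), of "\<lambda>Y. generates Y L UNIV \<and> profile Y W \<nu>"]
    by (simp only: restrict_UNIV)
  also have "\<dots> = (\<Sum>Y\<in>Hom UNIV C. if profile Y W \<nu> then \<Prod>i\<in>{c<..dim H}. q ^ dim UNIV - q ^ i else 0)"
    by (intro sum.cong refl inner)
  also have "\<dots> = card {Y \<in> Hom UNIV C. profile Y W \<nu>} * (\<Prod>i\<in>{c<..dim H}. q ^ dim UNIV - q ^ i)"
    by (subst sum.inter_filter[symmetric]) simp_all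
  also have "card {Y \<in> Hom UNIV C. profile Y W \<nu>} = q ^ c * qfall q c c * profile_factor q N \<nu>"
    using card_Hom_profile[where \<nu> = \<nu> and N = N, OF WC(1) assms(5,6)] dims assms(7) WC(2) by simp
  finally show ?thesis .
qed

text \<open>Pairs of a reachable \<open>Y\<close> and a subspace \<open>W\<close> through
  \<open>v\<close> are counted in two ways. By conjugacy every \<open>Y\<close> contributes the same
  unknown \<open>A\<close>, and every \<open>W\<close> contributes the number from
  \<open>card_reachable_profile\<close>.\<close>

lemma card_profile_containing:
  assumes "Vector_Spaces.linear scale scale f" "v \<noteq> 0" "generates f (span {v}) UNIV"
    and "\<And>i. N \<le> i \<Longrightarrow> \<nu> i = 0" "(\<Sum>i<N. \<nu> i) = dim UNIV" "0 < \<nu> 0" "\<nu> 0 \<le> dim UNIV"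
  shows "card {W. subspace W \<and> v \<in> W \<and> profile f W \<nu>} = profile_factor q N \<nu>"
proof -
  define L where "L = span {v}"
  define c where "c = dim UNIV - \<nu> 0"
  define k where "k = \<nu> 0 - 1"
  define A where "A = card {W. subspace W \<and> v \<in> W \<and> profile f W \<nu>}"
  have L: "subspace L" "dim L = 1" using dim_line[OF assms(2)] by (simp_all add: L_def)
  have vL: "v \<in> W \<longleftrightarrow> L \<subseteq> W" if "subspace W" for W
    using that span_minimal[of "{v}" W] span_base[of v "{v}"] by (auto simp: L_def)
  obtain H where H: "direct L H" "L + H = UNIV"
    using exists_complement[OF L(1) subspace_UNIV] by auto
  note s = direct_subspace[OF H(1)]
  have n: "dim UNIV = Suc (dim H)" using dim_plus[OF H(1)] H(2) L(2) by simp
  have kc: "dim H = k + c" using n assms(6,7) by (simp add: k_def c_def)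
  have c: "c \<le> dim H" using kc by simp
  let ?Y = "{Y \<in> Hom UNIV H. generates Y L UNIV}"
  let ?W = "{W. subspace W \<and> L \<subseteq> W \<and> dim W = \<nu> 0}"
  let ?Q = "\<Prod>i\<in>{c<..dim H}. q ^ dim UNIV - q ^ i"
  have each: "card {W \<in> ?W. profile Y W \<nu>} = A" if Y: "Y \<in> ?Y" for Y
  proof -
    have lin: "Vector_Spaces.linear scale scale Y" using HomD(1)[of Y UNIV H] Y by (simp add: linear_on_UNIV)
    have "{W \<in> ?W. profile Y W \<nu>} = {W. subspace W \<and> v \<in> W \<and> profile Y W \<nu>}"
      using vL profile_dim[of Y _ \<nu>] pair.linear_0[OF lin] by blast
    then show ?thesis
      using card_profile_containing_eq[OF assms(1) lin assms(2,3), of \<nu>] Y by (simp add: A_def L_def)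
  qed
  have "(\<Sum>Y\<in>?Y. card {W \<in> ?W. profile Y W \<nu>}) =
      (\<Sum>W\<in>?W. q ^ c * qfall q c c * profile_factor q N \<nu> * ?Q)"
  proof (rule sum_multicount_gen)
    show "\<forall>W\<in>?W. card {Y \<in> ?Y. profile Y W \<nu>} = q ^ c * qfall q c c * profile_factor q N \<nu> * ?Q"
      using card_reachable_profile[OF H, of _ \<nu> N c] assms(4,5) c_def by blast
  qed simp_all
  then have E: "card ?Y * A = card ?W * (q ^ c * qfall q c c * profile_factor q N \<nu> * ?Q)"
    using each by simp
  \<comment> \<open>The range is cut at \<open>c\<close> to expose the factor \<open>?Q\<close>,
    which also occurs on the other side and is cancelled.\<close>
  have Y: "card ?Y = q ^ c * qfall q (dim H) c * ?Q"
  proof -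
    have "{0<..dim H} = {0<..c} \<union> {c<..dim H}" using c by auto
    then have "card ?Y = (\<Prod>i\<in>{0<..c}. q ^ dim UNIV - q ^ i) * ?Q"
      unfolding card_reachable[OF H] by (simp add: prod.union_disjoint)
    then show ?thesis unfolding n qfall_shift_1 by simp
  qed
  have Q: "0 < ?Q"
  proof (rule prod_pos)
    fix i assume "i \<in> {c<..dim H}"
    then have "q ^ i < q ^ dim UNIV" using n q_gt_1 by (intro power_strict_increasing) auto
    then show "0 < q ^ dim UNIV - q ^ i" by simp
  qed
  have "(q ^ c * ?Q) * (qfall q (dim H) c * A) = (q ^ c * ?Q) * (card ?W * qfall q c c * profile_factor q N \<nu>)"
    using E unfolding Y by (simp only: mult_ac)
  moreover have "0 < q ^ c * ?Q" using Q q_gt_0 by (intro mult_pos_pos zero_less_power)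
  ultimately have eq: "qfall q (dim H) c * A = card ?W * qfall q c c * profile_factor q N \<nu>"
    by (blast intro: nat_mult_eq_cancel1[THEN iffD1])
  have W: "card ?W * qfall q k k = qfall q (dim H) k"
    using card_subspaces_containing[OF H, of k] card_subspaces[OF s(2), of k] L(2) assms(6)
    by (simp add: qfall_def k_def)
  \<comment> \<open>Symmetry of the Gaussian binomial: \<open>qfall q (dim H) (dim H)\<close> is
    split once at \<open>k\<close> and once at \<open>c\<close>.\<close>
  have "card ?W * qfall q c c * (qfall q k k * q ^ (k * c)) = qfall q (dim H) k * q ^ (k * c) * qfall q c c"
    using W by (simp add: mult_ac)
  also have "\<dots> = qfall q (dim H) (dim H)"
    unfolding kc by (rule qfall_add[symmetric])
  also have "\<dots> = qfall q (dim H) c * (qfall q k k * q ^ (k * c))"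
    using qfall_add[of q c k k] by (simp add: kc add.commute mult_ac)
  finally have "card ?W * qfall q c c = qfall q (dim H) c"
    using qfall_pos[OF q_gt_1, of k k] q_gt_1 by auto
  then have "qfall q (dim H) c * A = qfall q (dim H) c * profile_factor q N \<nu>"
    using eq by simp
  then show ?thesis
    using qfall_pos[OF q_gt_1 c] by (simp add: A_def)
qed

theorem card_profile:
  assumes "Vector_Spaces.linear scale scale f" "\<And>v. v \<noteq> 0 \<Longrightarrow> generates f (span {v}) UNIV"
    and "\<And>i. N \<le> i \<Longrightarrow> \<nu> i = 0" "(\<Sum>i<N. \<nu> i) = dim UNIV" "0 < \<nu> 0" "\<nu> 0 \<le> dim UNIV"
  shows "card {W. subspace W \<and> profile f W \<nu>} * (q ^ \<nu> 0 - 1) = (q ^ dim UNIV - 1) * profile_factor q N \<nu>"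
proof -
  let ?W = "{W. subspace W \<and> profile f W \<nu>}"
  have "(\<Sum>W\<in>?W. card {v \<in> - {0}. v \<in> W}) = (\<Sum>v\<in>- {0 :: 'b}. profile_factor q N \<nu>)"
  proof (rule sum_multicount_gen)
    show "\<forall>v\<in>- {0}. card {W \<in> ?W. v \<in> W} = profile_factor q N \<nu>"
    proof
      fix v :: 'b assume "v \<in> - {0}"
      then show "card {W \<in> ?W. v \<in> W} = profile_factor q N \<nu>"
        using card_profile_containing[where \<nu> = \<nu> and N = N and v = v, OF assms(1) _ assms(2) assms(3-6)]
        by (simp add: conj_commute conj_left_commute)
    qed
  qed simp_all
  moreover have "card {v \<in> - {0}. v \<in> W} = q ^ \<nu> 0 - 1" if W: "W \<in> ?W" for W
  proof -
    have "{v \<in> - {0}. v \<in> W} = W - {0}" by auto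
    then show ?thesis
      using W profile_dim[of f W \<nu>] pair.linear_0[OF assms(1)] card_eq_power_dim[of W]
      by (simp add: subspace_0)
  qed
  moreover have "card (- {0 :: 'b}) = q ^ dim UNIV - 1"
    using card_eq_power_dim[of UNIV] by (simp add: Compl_eq_Diff_UNIV)
  ultimately show ?thesis by simp
qed

end

section \<open>Operators with irreducible characteristic polynomial\<close>

text \<open>The product of \<open>A\<close> with its adjugate, in terms of determinants. Replacing
  row \<open>k\<close> by row \<open>i\<close> gives a determinant that is linear in that row; for
  \<open>i \<noteq> k\<close> it has two equal rows.\<close>

lemma row_expansion:
  fixes A :: "'a::comm_ring_1^'n^'n"
  shows "(\<Sum>j\<in>UNIV. A $ i $ j * det (\<chi> r. if r = k then axis j 1 else A $ r)) = (if i = k then det A else 0)"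
proof -
  have row: "A $ i = (\<Sum>j\<in>UNIV. A $ i $ j *s axis j 1)"
    by (simp add: vec_eq_iff axis_def if_distrib cong: if_cong)
  have "det (\<chi> r. if r = k then A $ i else A $ r) =
      (\<Sum>j\<in>UNIV. det (\<chi> r. if r = k then A $ i $ j *s axis j 1 else A $ r))"
    by (subst row, subst det_linear_row_sum) simp_all
  also have "\<dots> = (\<Sum>j\<in>UNIV. A $ i $ j * det (\<chi> r. if r = k then axis j 1 else A $ r))"
    by (simp add: det_row_mul)
  also have "det (\<chi> r. if r = k then A $ i else A $ r) = (if i = k then det A else 0)"
  proof (cases "i = k")
    case True
    then have "(\<chi> r. if r = k then A $ i else A $ r) = A" by (simp add: vec_eq_iff)
    then show ?thesis using True by simp
  next
    case False
    then show ?thesis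
      by (simp add: det_identical_rows[of i k] row_def vec_eq_iff)
  qed
  finally show ?thesis by simp
qed

section \<open>Polynomials in an operator and the Cayley-Hamilton theorem\<close>

definition poly_act :: "('a::field^'n \<Rightarrow> 'a^'n) \<Rightarrow> 'a poly \<Rightarrow> 'a^'n \<Rightarrow> 'a^'n" where
  "poly_act T p v = (\<Sum>i\<le>degree p. coeff p i *s (T ^^ i) v)"

context
  fixes T :: "'a::field^'n \<Rightarrow> 'a^'n"
  assumes lin: "Vector_Spaces.linear (*s) (*s) T"
begin

lemma poly_act_bound:
  assumes "degree p \<le> n"
  shows "poly_act T p v = (\<Sum>i\<le>n. coeff p i *s (T ^^ i) v)"
  unfolding poly_act_def
  using assms by (intro sum.mono_neutral_left) (auto simp: coeff_eq_0)

lemma poly_act_0 [simp]: "poly_act T 0 v = 0"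
  by (simp add: poly_act_def)

lemma poly_act_add: "poly_act T (p + r) v = poly_act T p v + poly_act T r v"
proof -
  let ?n = "max (degree p) (degree r)"
  have "degree (p + r) \<le> ?n" by (rule degree_add_le_max)
  then show ?thesis
    by (simp add: poly_act_bound[of _ ?n] vec.scale_left_distrib sum.distrib)
qed

lemma poly_act_pCons: "poly_act T (pCons a p) v = a *s v + T (poly_act T p v)"
proof -
  have "poly_act T (pCons a p) v = (\<Sum>i\<le>Suc (degree p). coeff (pCons a p) i *s (T ^^ i) v)"
    by (rule poly_act_bound) (rule degree_pCons_le)
  also have "\<dots> = a *s v + (\<Sum>i\<le>degree p. coeff p i *s T ((T ^^ i) v))"
    by (subst sum.atMost_Suc_shift) simp
  also have "\<dots> = a *s v + T (poly_act T p v)"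
    by (simp add: poly_act_def vec.linear_sum[OF lin] vec.linear_scale[OF lin])
  finally show ?thesis .
qed

lemma poly_act_linear: "Vector_Spaces.linear (*s) (*s) (poly_act T p)"
proof (induction p)
  case 0
  show ?case by (simp add: Vector_Spaces.linear_iff vec.vector_space_axioms)
next
  case (pCons a p)
  then show ?case
    by (simp add: Vector_Spaces.linear_iff vec.vector_space_axioms poly_act_pCons vec.linear_add[OF lin]
        vec.linear_scale[OF lin] vec.scale_right_distrib mult.commute add_ac)
qed

lemma poly_act_smult: "poly_act T (smult a p) v = a *s poly_act T p v"
  by (induction p) (simp_all add: poly_act_pCons vec.linear_scale[OF lin] vec.scale_right_distrib)

lemma poly_act_mult: "poly_act T (p * r) v = poly_act T p (poly_act T r v)"
  by (induction p) (simp_all add: mult_pCons_left poly_act_add poly_act_smult poly_act_pCons)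

lemma poly_act_diff: "poly_act T (p - r) v = poly_act T p v - poly_act T r v"
  using poly_act_add[of "p - r" r v] by simp

lemma poly_act_sum: "poly_act T (\<Sum>i\<in>S. f i) v = (\<Sum>i\<in>S. poly_act T (f i) v)"
  by (induction S rule: infinite_finite_induct) (simp_all add: poly_act_add)

lemma Cayley_Hamilton: "poly_act T (charpoly T) v = 0"
proof -
  define A :: "'a poly^'n^'n" where
    "A = (\<chi> i j. (if i = j then [:0, 1:] else 0) - [:matrix T $ i $ j:])"
  define D where "D k j = det (\<chi> r. if r = k then axis j 1 else A $ r)" for k j
  have pT: "poly_act T [:0, 1:] v = T v" and pc: "poly_act T [:c:] v = c *s v" for v c
    by (simp_all add: poly_act_pCons vec.linear_0[OF lin])
  \<comment> \<open>These relations in the module of polynomials acting through \<open>T\<close> are multiplied by the cofactors of \<open>A\<close>.\<close>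
  have col: "(\<Sum>i\<in>UNIV. poly_act T (A $ i $ j) (axis i 1)) = 0" for j
  proof -
    have "(\<Sum>i\<in>UNIV. poly_act T (A $ i $ j) (axis i 1)) =
        (\<Sum>i\<in>UNIV. (if i = j then T (axis i 1) else 0) - matrix T $ i $ j *s axis i 1)"
      by (intro sum.cong refl) (simp add: A_def poly_act_diff pT pc)
    also have "\<dots> = T (axis j 1) - (\<Sum>i\<in>UNIV. matrix T $ i $ j *s axis i 1)"
      by (simp add: sum_subtractf)
    also have "(\<Sum>i\<in>UNIV. matrix T $ i $ j *s axis i 1) = T (axis j 1)"
      by (simp add: vec_eq_iff matrix_def axis_def if_distrib cong: if_cong)
    finally show ?thesis by simp
  qed
  have basis: "poly_act T (charpoly T) (axis k 1) = 0" for k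
  proof -
    \<comment> \<open>The double sum is evaluated in two orders: summing over \<open>j\<close> first
      produces \<open>det A\<close> by cofactors, summing over \<open>i\<close> first produces the
      vanishing relations \<open>col\<close>.\<close>
    have "(\<Sum>i\<in>UNIV. \<Sum>j\<in>UNIV. poly_act T (D k j * A $ i $ j) (axis i 1)) =
        (\<Sum>i\<in>UNIV. poly_act T (\<Sum>j\<in>UNIV. A $ i $ j * D k j) (axis i 1))"
      by (simp add: poly_act_sum mult.commute)
    also have "\<dots> = (\<Sum>i\<in>UNIV. poly_act T (if i = k then det A else 0) (axis i 1))"
      by (simp only: row_expansion D_def)
    also have "\<dots> = poly_act T (det A) (axis k 1)"
      by (simp add: if_distrib[of "\<lambda>p. poly_act T p _"] cong: if_cong)
    finally have "poly_act T (det A) (axis k 1) =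
        (\<Sum>j\<in>UNIV. \<Sum>i\<in>UNIV. poly_act T (D k j * A $ i $ j) (axis i 1))"
      by (subst sum.swap) simp
    also have "\<dots> = (\<Sum>j\<in>UNIV. poly_act T (D k j) (\<Sum>i\<in>UNIV. poly_act T (A $ i $ j) (axis i 1)))"
      by (simp add: poly_act_mult vec.linear_sum[OF poly_act_linear])
    also have "\<dots> = 0" by (simp add: col vec.linear_0[OF poly_act_linear])
    finally show ?thesis by (simp add: charpoly_def A_def)
  qed
  have "v = (\<Sum>k\<in>UNIV. v $ k *s axis k 1)"
    by (simp add: vec_eq_iff axis_def if_distrib cong: if_cong)
  then have "poly_act T (charpoly T) v = (\<Sum>k\<in>UNIV. v $ k *s poly_act T (charpoly T) (axis k 1))"
    by (metis (no_types, lifting) sum.cong vec.linear_scale[OF poly_act_linear] vec.linear_sum[OF poly_act_linear])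
  then show ?thesis by (simp add: basis)
qed

end

section \<open>Degrees of polynomials annihilating a vector\<close>

lemma coeff_prod_card:
  fixes f :: "'b \<Rightarrow> 'a::comm_semiring_1 poly"
  assumes "finite S" "\<And>i. i \<in> S \<Longrightarrow> degree (f i) \<le> 1"
  shows "coeff (prod f S) (card S) = (\<Prod>i\<in>S. coeff (f i) 1) \<and> degree (prod f S) \<le> card S"
  using assms
proof (induction S rule: finite_induct)
  case (insert x S)
  then have IH: "coeff (prod f S) (card S) = (\<Prod>i\<in>S. coeff (f i) 1)" "degree (prod f S) \<le> card S"
    and x: "degree (f x) \<le> 1" by auto
  have "coeff (f x * prod f S) (1 + card S) = coeff (f x) 1 * coeff (prod f S) (card S)"
  proof -
    have "coeff (f x * prod f S) (1 + card S) =
        (\<Sum>i\<le>1 + card S. if i = 1 then coeff (f x) 1 * coeff (prod f S) (card S) else 0)"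
      unfolding coeff_mult
    proof (intro sum.cong refl)
      fix i
      show "coeff (f x) i * coeff (prod f S) (1 + card S - i) =
          (if i = 1 then coeff (f x) 1 * coeff (prod f S) (card S) else 0)"
        using x IH(2) by (cases i rule: nat.exhaust) (auto simp: coeff_eq_0)
    qed
    then show ?thesis by simp
  qed
  moreover have "degree (f x * prod f S) \<le> 1 + card S"
    using degree_mult_le[of "f x" "prod f S"] x IH(2) by linarith
  ultimately show ?case using insert.hyps IH(1) by simp
qed simp

text \<open>In the Leibniz formula the top coefficient of each product is the product of the linear
  coefficients, and these form the identity matrix. It yields that the polynomial is nonzero and a
  lower bound for its degree.\<close>

lemma coeff_charpoly:
  fixes T :: "'a::field^'n \<Rightarrow> 'a^'n"
  shows "coeff (charpoly T) CARD('n) = 1"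
proof -
  define A :: "'a poly^'n^'n" where
    "A = (\<chi> i j. (if i = j then [:0, 1:] else 0) - [:matrix T $ i $ j:])"
  have deg: "degree (A $ i $ j) \<le> 1" for i j
    by (simp add: A_def)
  have c1: "coeff (A $ i $ j) 1 = (mat 1 :: 'a^'n^'n) $ i $ j" for i j
    by (simp add: A_def mat_def)
  have "coeff (charpoly T) CARD('n) = coeff (det A) CARD('n)"
    by (simp add: charpoly_def A_def)
  also have "\<dots> = (\<Sum>p\<in>{p. p permutes UNIV}. of_int (sign p) * (\<Prod>i\<in>UNIV. coeff (A $ i $ p i) 1))"
  proof -
    have "coeff (of_int (sign p) * (\<Prod>i\<in>UNIV. A $ i $ p i)) CARD('n) =
        of_int (sign p) * (\<Prod>i\<in>UNIV. coeff (A $ i $ p i) 1)" for p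
      using coeff_prod_card[of "UNIV :: 'n set" "\<lambda>i. A $ i $ p i"] deg
      by (simp add: of_int_poly[symmetric] sign_def)
    then show ?thesis by (simp add: det_def coeff_sum)
  qed
  also have "\<dots> = det (mat 1 :: 'a^'n^'n)"
    unfolding det_def by (simp only: c1)
  finally show ?thesis by simp
qed

lemma poly_act_monom:
  assumes "Vector_Spaces.linear (*s) (*s) T"
  shows "poly_act T (monom c i) v = c *s (T ^^ i) v"
  using poly_act_bound[OF assms degree_monom_le, of c i v]
  by (simp add: if_distrib[of "\<lambda>c. c *s _"] cong: if_cong)

text \<open>Division with remainder: the remainder annihilates \<open>v\<close> as well and has
  smaller degree unless it is zero.\<close>

lemma poly_act_minimal_dvd:
  fixes T :: "'a::field^'n \<Rightarrow> 'a^'n"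
  assumes lin: "Vector_Spaces.linear (*s) (*s) T"
    and d: "poly_act T d v = 0"
    and p: "p \<noteq> 0" "poly_act T p v = 0" "\<And>r. r \<noteq> 0 \<Longrightarrow> poly_act T r v = 0 \<Longrightarrow> degree p \<le> degree r"
  shows "p dvd d"
proof -
  have "poly_act T (d div p * p) v = poly_act T (d div p) 0"
    using p(2) by (simp add: poly_act_mult[OF lin])
  then have "poly_act T (d div p * p) v = 0"
    by (simp add: vec.linear_0[OF poly_act_linear[OF lin]])
  then have "poly_act T (d mod p) v = 0"
    using poly_act_add[OF lin, of "d div p * p" "d mod p" v] d by simp
  then have "d mod p = 0"
    using p(3)[of "d mod p"] degree_mod_less[OF p(1), of d] not_le by blast
  then show ?thesis by auto
qed

text \<open>An annihilator of \<open>v\<close> of least degree divides the characteristic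
  polynomial. It is no unit, since a nonzero constant cannot kill \<open>v\<close>; so by
  irreducibility the cofactor is a unit and the degrees agree.\<close>

lemma irreducible_charpoly_degree:
  fixes T :: "'a::field^'n \<Rightarrow> 'a^'n"
  assumes lin: "Vector_Spaces.linear (*s) (*s) T" and irr: "irreducible (charpoly T)"
    and v: "v \<noteq> 0" and p: "p \<noteq> 0" "poly_act T p v = 0"
  shows "CARD('n) \<le> degree p"
proof -
  define P where "P r \<longleftrightarrow> r \<noteq> 0 \<and> poly_act T r v = 0" for r
  obtain m where m: "P m" "\<And>r. P r \<Longrightarrow> degree m \<le> degree r"
    using ex_has_least_nat[of P p degree] p P_def by blast
  have "m dvd charpoly T"
    using m by (intro poly_act_minimal_dvd[OF lin Cayley_Hamilton[OF lin]]) (auto simp: P_def)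
  then obtain s where s: "charpoly T = m * s" by (elim dvdE)
  have "\<not> is_unit m"
  proof
    assume "is_unit m"
    then obtain c where c: "m = [:c:]" "c \<noteq> 0"
      using m(1) by (auto simp: P_def is_unit_iff_degree elim: degree_eq_zeroE)
    then show False using m(1) v by (simp add: P_def poly_act_def)
  qed
  then have "is_unit s" using irreducibleD[OF irr s] by blast
  moreover have "s \<noteq> 0" using s coeff_charpoly[of T] by auto
  ultimately have "degree (charpoly T) = degree m"
    using s m(1) is_unit_iff_degree[of s] by (simp add: P_def degree_mult_eq)
  moreover have "CARD('n) \<le> degree (charpoly T)"
    using coeff_charpoly[of T] by (intro le_degree) simp
  ultimately show ?thesis using m(2)[of p] p by (simp add: P_def)
qed

text \<open>The dependent case names the last vector of a relation, so that the polynomial built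
  from it has leading coefficient \<open>1\<close>.\<close>

lemma (in finite_vector_space) krylov_independent:
  "(\<exists>i<n. k i \<in> span (k ` {..<i})) \<or> (independent (k ` {..<n::nat}) \<and> inj_on k {..<n})"
proof (induction n)
  case (Suc n)
  show ?case
  proof (cases "\<exists>i<Suc n. k i \<in> span (k ` {..<i})")
    case False
    then have k: "independent (k ` {..<n})" "inj_on k {..<n}" "k n \<notin> span (k ` {..<n})"
      using Suc by auto
    have "k n \<notin> k ` {..<n}" using k(3) span_base[of "k n" "k ` {..<n}"] by metis
    then have "independent (k ` {..<Suc n})" "inj_on k {..<Suc n}"
      using k by (auto simp: lessThan_Suc independent_insert)
    then show ?thesis by blast
  qed simp
qed (simp add: independent_empty)

text \<open>All iterates of \<open>v\<close> stay in \<open>R\<close>. If \<open>R\<close> were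
  proper, \<open>dim R + 1\<close> of them would be dependent, and \<open>v\<close> would have a
  nonzero annihilator of degree less than \<open>CARD('n)\<close>.\<close>

lemma irreducible_charpoly_invariant:
  fixes T :: "'a::{field,finite}^'n \<Rightarrow> 'a^'n"
  assumes lin: "Vector_Spaces.linear (*s) (*s) T" and irr: "irreducible (charpoly T)"
    and v: "v \<noteq> 0" and R: "vec.subspace R" "v \<in> R" "T ` R \<subseteq> R"
  shows "R = UNIV"
proof (rule ccontr)
  interpret fv: finite_vector_space "(*s) :: 'a \<Rightarrow> 'a^'n \<Rightarrow> 'a^'n" "CARD('a)"
    by unfold_locales simp
  assume "R \<noteq> UNIV"
  then have "vec.dim R \<noteq> vec.dim (UNIV :: ('a^'n) set)"
    using fv.subspace_dim_equal[OF R(1) vec.subspace_UNIV] by auto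
  then have less: "vec.dim R < CARD('n)"
    using fv.dim_mono_subspace[OF R(1) vec.subspace_UNIV] vec_dim_card[where 'n = 'n and 'a = 'a] by simp
  let ?k = "\<lambda>i. (T ^^ i) v"
  have kR: "?k i \<in> R" for i
    by (induction i) (use R in auto)
  have "\<exists>i<Suc (vec.dim R). ?k i \<in> vec.span (?k ` {..<i})"
  proof (rule ccontr)
    assume "\<not> ?thesis"
    then have *: "vec.independent (?k ` {..<Suc (vec.dim R)})" "inj_on ?k {..<Suc (vec.dim R)}"
      using fv.krylov_independent[of "Suc (vec.dim R)" ?k] by auto
    have "card (?k ` {..<Suc (vec.dim R)}) \<le> vec.dim R"
      using kR by (intro vec.independent_card_le_dim *(1)) auto
    then show False using card_image[OF *(2)] by simp
  qed
  then obtain m where m: "m \<le> vec.dim R" "?k m \<in> vec.span (?k ` {..<m})"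
    using less_Suc_eq_le by blast
  obtain a where a: "?k m = (\<Sum>i<m. a i *s ?k i)"
    using fv.span_image_lessThan[OF m(2)] by blast
  define p where "p = monom 1 m - (\<Sum>i<m. monom (a i) i)"
  have "coeff p m = 1" by (simp add: p_def coeff_sum)
  then have "p \<noteq> 0" by auto
  moreover have "poly_act T p v = 0"
    using a by (simp add: p_def poly_act_diff[OF lin] poly_act_sum[OF lin] poly_act_monom[OF lin])
  moreover have "degree p \<le> m"
    unfolding p_def
  proof (intro degree_diff_le degree_monom_le degree_sum_le)
    show "degree (monom (a i) i) \<le> m" if "i \<in> {..<m}" for i
      using degree_monom_le[of "a i" i] that by simp
  qed simp
  ultimately show False
    using irreducible_charpoly_degree[OF lin irr v, of p] m(1) less by simp
qed

section \<open>Translation into the notions of the theorem\<close>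

lemma card_coord_space: "card (coord_space a :: (nat \<Rightarrow> 'a::{field,finite}) set) = CARD('a) ^ a"
  and finite_coord_space: "finite (coord_space a :: (nat \<Rightarrow> 'a) set)"
proof -
  have "bij_betw (\<lambda>f. restrict f {..<a}) (coord_space a) ({..<a} \<rightarrow>\<^sub>E (UNIV :: 'a set))"
  proof (rule bij_betw_byWitness[where f' = "\<lambda>g i. if i < a then g i else 0"])
  qed (auto simp: coord_space_def fun_eq_iff PiE_def extensional_def)
  then show "card (coord_space a :: (nat \<Rightarrow> 'a) set) = CARD('a) ^ a" "finite (coord_space a :: (nat \<Rightarrow> 'a) set)"
    by (auto simp: bij_betw_same_card card_PiE bij_betw_finite finite_PiE)
qed

lemma q_binomial_eq: "q_binomial TYPE('a::{field,finite}) a b = qbin CARD('a) a b"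
proof -
  interpret fs: vector_space_over_finite "\<lambda>(c::'a) (f::nat \<Rightarrow> 'a) i. c * f i" "CARD('a)"
    by unfold_locales simp
  have s: "fun_space.subspace (coord_space a :: (nat \<Rightarrow> 'a) set)"
    by (auto simp: fun_space.subspace_def coord_space_def)
  have "fun_space.dim (coord_space a :: (nat \<Rightarrow> 'a) set) = a"
    by (rule fs.dim_eqI[OF s finite_coord_space card_coord_space])
  then have "q_binomial TYPE('a) a b * qfall CARD('a) b b = qfall CARD('a) a b"
    using fs.card_subspaces[OF s finite_coord_space, of b] by (simp add: q_binomial_def qfall_def)
  also have "\<dots> = qbin CARD('a) a b * qfall CARD('a) b b"
    by (rule qbin_qfall[OF fs.q_gt_1, symmetric])
  finally show ?thesis using qfall_pos[OF fs.q_gt_1, of b b] by simp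
qed

text \<open>The term \<open>i = 0\<close> is the summand \<open>W\<close>, and one \<open>T\<close>
  is pulled out of all the others; this is the recursion of \<open>krylov_sum\<close>.\<close>

lemma iterate_sum_Suc:
  assumes "Vector_Spaces.linear (*s) (*s) T"
  shows "iterate_sum T (Suc j) W = W + T ` iterate_sum T j W"
proof (intro subset_antisym subsetI)
  fix x assume "x \<in> iterate_sum T (Suc j) W"
  then obtain w where w: "\<forall>i<Suc j. w i \<in> W" "x = (\<Sum>i<Suc j. (T ^^ i) (w i))"
    by (auto simp: iterate_sum_def)
  have "x = w 0 + T (\<Sum>i<j. (T ^^ i) (w (Suc i)))"
    unfolding w(2) sum.lessThan_Suc_shift by (simp add: vec.linear_sum[OF assms])
  moreover have "(\<Sum>i<j. (T ^^ i) (w (Suc i))) \<in> iterate_sum T j W"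
    unfolding iterate_sum_def mem_Collect_eq
    by (rule exI[of _ "\<lambda>i. w (Suc i)"]) (use w(1) in simp)
  ultimately show "x \<in> W + T ` iterate_sum T j W" using w(1) by auto
next
  fix x assume "x \<in> W + T ` iterate_sum T j W"
  then obtain w0 w where w: "w0 \<in> W" "\<forall>i<j. w i \<in> W" "x = w0 + T (\<Sum>i<j. (T ^^ i) (w i))"
    by (auto simp: iterate_sum_def elim!: set_plus_elim)
  let ?w = "case_nat w0 w"
  have "x = (\<Sum>i<Suc j. (T ^^ i) (?w i))"
    unfolding w(3) sum.lessThan_Suc_shift by (simp add: vec.linear_sum[OF assms])
  moreover have "\<forall>i<Suc j. ?w i \<in> W" using w(1,2) by (auto split: nat.split)
  ultimately show "x \<in> iterate_sum T (Suc j) W"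
    unfolding iterate_sum_def by blast
qed

lemma partition_of_bounded:
  assumes "partition_of n \<mu>" "0 < n"
  obtains N where "\<And>i. N \<le> i \<Longrightarrow> \<mu> (Suc i) = 0" "{i. 1 \<le> i \<and> \<mu> i \<noteq> 0} \<subseteq> {1..<Suc N}"
    "(\<Sum>i<N. \<mu> (Suc i)) = n" "0 < \<mu> 1" "\<mu> 1 \<le> n"
proof -
  let ?S = "{i. 1 \<le> i \<and> \<mu> i \<noteq> 0}"
  have mono: "\<And>i j. 1 \<le> i \<Longrightarrow> i \<le> j \<Longrightarrow> \<mu> j \<le> \<mu> i" and fin: "finite ?S" and sum: "(\<Sum>i\<in>?S. \<mu> i) = n"
    using assms(1) by (auto simp: partition_of_def)
  obtain N where N: "\<forall>i\<in>?S. i < N"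
    using fin finite_nat_set_iff_bounded by blast
  have sub: "?S \<subseteq> {1..<Suc N}" using N by auto
  have zero: "\<mu> (Suc i) = 0" if "N \<le> i" for i
  proof (rule ccontr)
    assume "\<mu> (Suc i) \<noteq> 0"
    then have "Suc i \<in> ?S" by simp
    then have "Suc i < N" using N by blast
    then show False using that by simp
  qed
  have "(\<Sum>i<N. \<mu> (Suc i)) = (\<Sum>i\<in>{1..<Suc N}. \<mu> i)"
    by (rule sum.reindex_bij_witness[where i = "\<lambda>i. i - 1" and j = Suc]) auto
  also have "\<dots> = n"
    unfolding sum[symmetric] using sub by (intro sum.mono_neutral_right) auto
  finally have total: "(\<Sum>i<N. \<mu> (Suc i)) = n" .
  have pos: "0 < \<mu> 1"
  proof (rule ccontr)
    assume "\<not> 0 < \<mu> 1"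
    then have "\<mu> i = 0" if "1 \<le> i" for i using mono[of 1 i] that by simp
    then have "?S = {}" by auto
    then show False using sum assms(2) by simp
  qed
  have "1 \<in> ?S" using pos by simp
  from member_le_sum[OF this _ fin, of \<mu>] have "\<mu> 1 \<le> n" unfolding sum by simp
  with zero sub total pos show thesis by (rule that)
qed

theorem theorem2p8:
  fixes T :: "'a::{field,finite}^'n \<Rightarrow> 'a^'n"
    and \<mu> :: "nat \<Rightarrow> nat"
    and q n :: nat
  assumes "CARD('a) = q"
    and "CARD('n) = n"
    and "Vector_Spaces.linear (*s) (*s) T"
    and "irreducible (charpoly T)"
    and "partition_of n \<mu>"
  shows "real (profile_count \<mu> T) =
    (real q ^ n - 1) / (real q ^ \<mu> 1 - 1) *
    real q ^ (\<Sum>j | 2 \<le> j \<and> \<mu> j \<noteq> 0. (\<mu> j)\<^sup>2 - \<mu> j) *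
    (\<Prod>i | 1 \<le> i \<and> \<mu> i \<noteq> 0. real (q_binomial TYPE('a) (\<mu> i) (\<mu> (i + 1))))"
proof -
  interpret fv: finite_vector_space "(*s) :: 'a \<Rightarrow> 'a^'n \<Rightarrow> 'a^'n" q
    by unfold_locales (rule assms(1))
  note lin = assms(3)
  let ?\<nu> = "\<lambda>i. \<mu> (Suc i)"
  have "0 < n" using assms(2) by auto
  then obtain N where N: "\<And>i. N \<le> i \<Longrightarrow> \<mu> (Suc i) = 0" "{i. 1 \<le> i \<and> \<mu> i \<noteq> 0} \<subseteq> {1..<Suc N}"
    "(\<Sum>i<N. \<mu> (Suc i)) = n" "0 < \<mu> 1" "\<mu> 1 \<le> n"
    using partition_of_bounded[OF assms(5)] by metis
  have dimU: "vec.dim (UNIV :: ('a^'n) set) = n"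
    using vec_dim_card[where 'n = 'n and 'a = 'a] assms(2) by simp
  have iter: "iterate_sum T j W = fv.krylov_sum T j W" for j W
  proof (induction j)
    case 0
    then show ?case by (auto simp: iterate_sum_def)
  next
    case (Suc j)
    then show ?case by (simp add: iterate_sum_Suc[OF lin])
  qed
  have "has_profile T \<mu> W \<longleftrightarrow> vec.subspace W \<and> fv.profile T W ?\<nu>" for W
  proof -
    have shift: "(\<Sum>i=1..j. \<mu> i) = (\<Sum>i<j. \<mu> (Suc i))" for j
      by (rule sum.reindex_bij_witness[where i = Suc and j = "\<lambda>i. i - 1"]) auto
    have "(\<forall>j\<ge>1. vec.dim (fv.krylov_sum T j W) = (\<Sum>i<j. \<mu> (Suc i))) \<longleftrightarrow> fv.profile T W ?\<nu>"
      unfolding fv.profile_def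
    proof (intro iffI allI)
      fix j assume *: "\<forall>j\<ge>1. vec.dim (fv.krylov_sum T j W) = (\<Sum>i<j. \<mu> (Suc i))"
      \<comment> \<open>\<open>profile\<close> also speaks of \<open>j = 0\<close>, where both sides
        are \<open>0\<close>.\<close>
      show "vec.dim (fv.krylov_sum T j W) = (\<Sum>i<j. \<mu> (Suc i))"
        using * by (cases j) (auto simp del: fv.krylov_sum.simps(2))
    qed simp
    then show ?thesis by (simp add: has_profile_def iter shift[unfolded One_nat_def])
  qed
  then have count: "profile_count \<mu> T = card {W. vec.subspace W \<and> fv.profile T W ?\<nu>}"
    by (simp add: profile_count_def)
  have generates: "fv.generates T (vec.span {v}) UNIV" if "v \<noteq> 0" for v
    unfolding fv.generates_def
  proof (intro allI impI, elim conjE)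
    fix R assume "vec.subspace R" "vec.span {v} \<subseteq> R" "T ` R \<subseteq> R"
    then show "R = UNIV"
      using vec.span_base[of v "{v}"] by (intro irreducible_charpoly_invariant[OF lin assms(4) that]) auto
  qed
  have main: "profile_count \<mu> T * (q ^ \<mu> 1 - 1) = (q ^ n - 1) * profile_factor q N ?\<nu>"
    using fv.card_profile[where N = N and \<nu> = ?\<nu>, OF lin generates N(1)] N(3-5)
    unfolding count dimU One_nat_def by blast
  have prod: "(\<Prod>i | 1 \<le> i \<and> \<mu> i \<noteq> 0. q_binomial TYPE('a) (\<mu> i) (\<mu> (i + 1))) =
      (\<Prod>i<N. qbin q (?\<nu> i) (?\<nu> (Suc i)))"
  proof -
    have "(\<Prod>i | 1 \<le> i \<and> \<mu> i \<noteq> 0. q_binomial TYPE('a) (\<mu> i) (\<mu> (i + 1))) =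
        (\<Prod>i\<in>{1..<Suc N}. qbin q (\<mu> i) (\<mu> (i + 1)))"
      unfolding q_binomial_eq assms(1)
    \<comment> \<open>The added indices contribute \<open>qbin q 0 0 = 1\<close>, because the part
      after a zero part is zero.\<close>
    proof (rule prod.mono_neutral_left[OF _ N(2)], simp, rule ballI)
      fix i assume "i \<in> {1..<Suc N} - {i. 1 \<le> i \<and> \<mu> i \<noteq> 0}"
      then have "1 \<le> i" "\<mu> i = 0" by auto
      moreover from this have "\<mu> (i + 1) = 0"
        using assms(5) unfolding partition_of_def by (metis le_add1 le_zero_eq)
      ultimately show "qbin q (\<mu> i) (\<mu> (i + 1)) = 1" by simp
    qed
    also have "\<dots> = (\<Prod>i<N. qbin q (?\<nu> i) (?\<nu> (Suc i)))"
      by (rule prod.reindex_bij_witness[where i = Suc and j = "\<lambda>i. i - 1"]) auto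
    finally show ?thesis .
  qed
  have expo: "(\<Sum>j | 2 \<le> j \<and> \<mu> j \<noteq> 0. (\<mu> j)\<^sup>2 - \<mu> j) = (\<Sum>i<N. (?\<nu> (Suc i))\<^sup>2 - ?\<nu> (Suc i))"
  proof -
    have "j < N + 2" if "2 \<le> j" "\<mu> j \<noteq> 0" for j
    proof -
      have "j \<in> {i. 1 \<le> i \<and> \<mu> i \<noteq> 0}" using that by simp
      then have "j \<in> {1..<Suc N}" using N(2) by blast
      then show ?thesis by simp
    qed
    \<comment> \<open>The range runs to \<open>N + 1\<close> in order to match
      \<open>?\<nu> (Suc i)\<close> for \<open>i < N\<close>; the added terms are zero.\<close>
    then have "(\<Sum>j | 2 \<le> j \<and> \<mu> j \<noteq> 0. (\<mu> j)\<^sup>2 - \<mu> j) = (\<Sum>j\<in>{2..<N + 2}. (\<mu> j)\<^sup>2 - \<mu> j)"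
      by (intro sum.mono_neutral_left) auto
    also have "\<dots> = (\<Sum>i<N. (?\<nu> (Suc i))\<^sup>2 - ?\<nu> (Suc i))"
      using sum.shift_bounds_nat_ivl[of "\<lambda>j. (\<mu> j)\<^sup>2 - \<mu> j" 0 2 N]
      by (simp only: numeral_2_eq_2 add_0 add_0_right add_Suc_right atLeast0LessThan)
    finally show ?thesis .
  qed
  have factor: "profile_factor q N ?\<nu> =
      (\<Prod>i | 1 \<le> i \<and> \<mu> i \<noteq> 0. q_binomial TYPE('a) (\<mu> i) (\<mu> (i + 1))) *
      q ^ (\<Sum>j | 2 \<le> j \<and> \<mu> j \<noteq> 0. (\<mu> j)\<^sup>2 - \<mu> j)"
    unfolding profile_factor_def prod expo by (simp add: prod.distrib power_sum)
  have gt: "1 < q ^ \<mu> 1" by (rule one_less_power[OF fv.q_gt_1 N(4)])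
  have le: "1 \<le> q ^ k" for k using fv.q_gt_0 by (simp add: Suc_le_eq)
  have "real (profile_count \<mu> T) * (real q ^ \<mu> 1 - 1) = (real q ^ n - 1) * real (profile_factor q N ?\<nu>)"
    using arg_cong[OF main, of real] le by (simp add: of_nat_diff)
  moreover have "real q ^ \<mu> 1 - 1 \<noteq> 0"
    using gt by (metis eq_iff_diff_eq_0 less_irrefl of_nat_1_eq_iff of_nat_power)
  ultimately show ?thesis
    unfolding factor by (simp add: field_simps)
qed

end
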